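(* Let $\mathcal{C}=\{C_\theta:\theta\in\mathcal{O}\}$, with $\mathcal{O}\subset\mathbb{R}^p$, be a parametric family of copulas that are left-tail decreasing (LTD) in both arguments. Let $(X_1,Y_1),\ldots,(X_n,Y_n)$ be a random sample from a bivariate distribution with continuous margins and copula $C=C_{\theta_0}$ for some $\theta_0\in\mathcal{O}$. Let $\theta_n$ be a rank-based, $\mathcal{O}$-valued estimator of $\theta_0$ and $\Theta_n=\sqrt{n}(\theta_n-\theta_0)$. Let $\mathcal{A}^{\mathrm{P}}=\{A_{C_\theta}^{\mathrm{P}}:\theta\in\mathcal{O}\}$ and $\mathcal{A}^{\mathrm{CFG}}=\{A_{C_\theta}^{\mathrm{CFG}}:\theta\in\mathcal{O}\}$. For a family $\{A_\theta:\theta\in\mathcal{O}\}$ of functions on $[0,1]$ consider the conditions: (A) $\mathcal{O}$ is an open subset of $\mathbb{R}^p$; (B) for every $\theta\in\mathcal{O}$, $A_\theta$ is twice continuously differentiable on $(0,1)$; (C) for every $\theta\in\mathcal{O}$, the gradient $\dot A_\theta(t)$ of $A_\theta(t)$ with respect to $\theta$ satisfies $\lim_{\epsilon\downarrow0}\sup_{\|\theta^*-\theta\|<\epsilon}\sup_{t\in[0,1]}\|\dot A_{\theta^*}(t)-\dot A_\theta(t)\|=0$, where $\|\cdot\|$ is the $\ell_2$-norm. (a) Suppose $\mathcal{A}^{\mathrm{P}}$, with $A_\theta=A_{C_\theta}^{\mathrm{P}}$, meets (A)–(C), and that $(\sqrt{n}(A_n^{\mathrm{P}}-A_C^{\mathrm{P}}),\Theta_n)$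 converges weakly to a Gaussian limit $(\mathbb{A}_C^{\mathrm{P}},\Theta)$ as $n\to\infty$. Then $$\sqrt{n}\,(A_n^{\mathrm{P}}-A_{\theta_n})\rightsquigarrow\mathbb{A}_C^{\mathrm{P}}-\dot A_{\theta_0}^\top\Theta\quad\text{as } n\to\infty\text{ in }\mathcal{C}[0,1].$$ (b) Suppose $\mathcal{A}^{\mathrm{CFG}}$, with $A_\theta=A_{C_\theta}^{\mathrm{CFG}}$, meets (A)–(C), and that $(\sqrt{n}(A_n^{\mathrm{CFG}}-A_C^{\mathrm{CFG}}),\Theta_n)$ converges weakly to a Gaussian limit $(\mathbb{A}_C^{\mathrm{CFG}},\Theta)$ as $n\to\infty$. Then $$\sqrt{n}\,(A_n^{\mathrm{CFG}}-A_{\theta_n})\rightsquigarrow\mathbb{A}_C^{\mathrm{CFG}}-\dot A_{\theta_0}^\top\Theta\quad\text{as } n\to\infty\text{ in }\mathcal{C}[0,1].$$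
   Context: The copula of a pair $(X,Y)$ with continuous margins $F,G$ is the joint distribution function of $(F(X),G(Y))$. A copula $C$ is LTD in both arguments if $C(u,v)/(uv)\ge C(u',v')/(u'v')$ for all $0<u\le u'\le1$ and $0<v\le v'\le1$. For a copula $C$ and $t\in[0,1]$, $$A_C^{\mathrm{P}}(t)=1\Big/\int_0^1C(x^{1-t},x^t)\frac{dx}{x},\qquad A_C^{\mathrm{CFG}}(t)=\exp\Big[-\gamma+\int_0^1\{C(x^{1-t},x^t)-\mathbf{1}(x>e^{-1})\}\frac{dx}{x\log(x)}\Big],$$ where $\gamma=-\int_0^\infty\log(x)e^{-x}\,dx$ is Euler's constant. Normalized ranks: $U_i=F_n(X_i)$, $V_i=G_n(Y_i)$, where $F_n(x)=\frac{1}{n+1}\sum_{i=1}^n\mathbf{1}(X_i\le x)$ and $G_n(y)=\frac{1}{n+1}\sum_{i=1}^n\mathbf{1}(Y_i\le y)$. "Rank-based" means a function of $(U_1,V_1),\ldots,(U_n,V_n)$. For $i\in\{1,\ldots,n\}$ let $\xi_i(0)=-\log U_i$, $\xi_i(1)=-\log V_i$ and, for $t\in(0,1)$, $\xi_i(t)=\min\{-\log(U_i)/(1-t),\,-\log(V_i)/t\}$. The estimators are $$A_n^{\mathrm{P}}(t)=1\Big/\Big\{\frac1n\sum_{i=1}^n\xi_i(t)\Big\},\qquad A_n^{\mathrm{CFG}}(t)=\exp\Big[-\gamma-\frac1n\sum_{i=1}^n\log\{\xi_i(t)\}\Big],\quad t\in[0,1].$$ The limits are $$\mathbb{A}_C^{\mathrm{P}}(t)=-\{A_C^{\mathrm{P}}(t)\}^2\int_0^1\mathbb{C}(x^{1-t},x^t)\frac{dx}{x},\qquad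 \mathbb{A}_C^{\mathrm{CFG}}(t)=A_C^{\mathrm{CFG}}(t)\int_0^1\mathbb{C}(x^{1-t},x^t)\frac{dx}{x\log(x)},$$ where $\mathbb{C}$ is the Gaussian weak limit of the empirical copula process $\sqrt n(C_n-C)$, $C_n(u,v)=\frac1n\sum_{i=1}^n\mathbf{1}(U_i\le u,V_i\le v)$. $\rightsquigarrow$ denotes weak convergence; $\mathcal{C}[0,1]$ is the space of continuous functions on $[0,1]$ with the supremum norm (not to be confused with the copula family $\mathcal{C}$). The joint convergence hypotheses are in $\mathcal{C}[0,1]\times\mathbb{R}^p$. *)

theory Defs
  imports "HOL-Probability.Probability"
begin

section \<open>Weak convergence in metric spaces\<close>

definition borel_metric :: "'a metric \<Rightarrow> 'a measure" where
  "borel_metric m = sigma (mspace m) {U. openin (mtopology_of m) U}"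

definition weakly_converges ::
  "'s metric \<Rightarrow> 'w measure \<Rightarrow> (nat \<Rightarrow> 'w \<Rightarrow> 's) \<Rightarrow> 'v measure \<Rightarrow> ('v \<Rightarrow> 's) \<Rightarrow> bool" where
  "weakly_converges m M Z N Z\<^sub>0 \<longleftrightarrow>
     (\<forall>n. Z n \<in> M \<rightarrow>\<^sub>M borel_metric m) \<and> Z\<^sub>0 \<in> N \<rightarrow>\<^sub>M borel_metric m \<and>
     (\<forall>f. continuous_map (mtopology_of m) euclideanreal f \<and> bounded (f ` mspace m) \<longrightarrow>
        (\<lambda>n. \<integral>\<omega>. f (Z n \<omega>) \<partial>M) \<longlonglongrightarrow> (\<integral>\<omega>. f (Z\<^sub>0 \<omega>) \<partial>N))"

text \<open>
  The library metric spaces of functions consist of extensional functions, so random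
  functions with values in them are written with \<^const>\<open>restrict\<close>. The space \<open>C_unit\<close> is the
  space of continuous functions on the unit interval and \<open>linf_unit_square\<close> the space of
  bounded functions on the unit square, both with the supremum metric.
\<close>

definition C_unit :: "(real \<Rightarrow> real) metric" where
  "C_unit = cfunspace (top_of_set {0..1}) euclidean_metric"

definition linf_unit_square :: "(real \<times> real \<Rightarrow> real) metric" where
  "linf_unit_square = funspace ({0..1} \<times> {0..1}) euclidean_metric"

section \<open>Gaussian limits\<close>

text \<open>Degenerate normal laws are included.\<close>

definition gaussian_rv :: "'v measure \<Rightarrow> ('v \<Rightarrow> real) \<Rightarrow> bool" where
  "gaussian_rv N Z \<longleftrightarrow> Z \<in> borel_measurable N \<and>
     ((\<exists>\<mu> \<sigma>. \<sigma> > 0 \<and> distributed N lborel Z (\<lambda>x. ennreal (normal_density \<mu> \<sigma> x))) \<or>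
      (\<exists>\<mu>. AE \<omega> in N. Z \<omega> = \<mu>))"

definition gaussian_process :: "'v measure \<Rightarrow> 'i set \<Rightarrow> ('v \<Rightarrow> 'i \<Rightarrow> real) \<Rightarrow> bool" where
  "gaussian_process N I Z \<longleftrightarrow>
     (\<forall>J c. finite J \<and> J \<subseteq> I \<longrightarrow> gaussian_rv N (\<lambda>\<omega>. \<Sum>j\<in>J. c j * Z \<omega> j))"

text \<open>Joint Gaussianity of a process and a random vector.\<close>

definition gaussian_pair ::
  "'v measure \<Rightarrow> 'i set \<Rightarrow> ('v \<Rightarrow> 'i \<Rightarrow> real) \<Rightarrow> ('v \<Rightarrow> 'b::euclidean_space) \<Rightarrow> bool" where
  "gaussian_pair N I Z W \<longleftrightarrow>
     (\<forall>J c b. finite J \<and> J \<subseteq> I \<longrightarrow>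
        gaussian_rv N (\<lambda>\<omega>. (\<Sum>j\<in>J. c j * Z \<omega> j) + b \<bullet> W \<omega>))"

section \<open>Copulas\<close>

text \<open>\<open>has_copula H C\<close>: the bivariate law \<open>H\<close> has continuous margins \<open>F\<close>, \<open>G\<close>, and on the unit
  square \<open>C\<close> is the joint distribution function of \<open>(F(X), G(Y))\<close> for \<open>(X, Y)\<close> with law \<open>H\<close>.
  The values of \<open>C\<close> outside the unit square are irrelevant.\<close>

definition has_copula :: "(real \<times> real) measure \<Rightarrow> (real \<Rightarrow> real \<Rightarrow> real) \<Rightarrow> bool" where
  "has_copula H C \<longleftrightarrow> prob_space H \<and> sets H = sets borel \<and>
     (let F = cdf (distr H borel fst); G = cdf (distr H borel snd) in
        continuous_on UNIV F \<and> continuous_on UNIV G \<and>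
        (\<forall>u\<in>{0..1}. \<forall>v\<in>{0..1}. C u v = measure H {z. F (fst z) \<le> u \<and> G (snd z) \<le> v}))"

definition copula :: "(real \<Rightarrow> real \<Rightarrow> real) \<Rightarrow> bool" where
  "copula C \<longleftrightarrow> (\<exists>H. has_copula H C)"

definition LTD :: "(real \<Rightarrow> real \<Rightarrow> real) \<Rightarrow> bool" where
  "LTD C \<longleftrightarrow> (\<forall>u u' v v'. 0 < u \<and> u \<le> u' \<and> u' \<le> 1 \<and> 0 < v \<and> v \<le> v' \<and> v' \<le> 1 \<longrightarrow>
     C u v / (u * v) \<ge> C u' v' / (u' * v'))"

definition A_P :: "(real \<Rightarrow> real \<Rightarrow> real) \<Rightarrow> real \<Rightarrow> real" where
  "A_P C t = 1 / (LBINT x:{0<..<1}. C (x powr (1 - t)) (x powr t) / x)"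

definition A_CFG :: "(real \<Rightarrow> real \<Rightarrow> real) \<Rightarrow> real \<Rightarrow> real" where
  "A_CFG C t = exp (- euler_mascheroni +
     (LBINT x:{0<..<1}. (C (x powr (1 - t)) (x powr t) - of_bool (x > exp (- 1))) / (x * ln x)))"

section \<open>Ranks and rank-based estimators\<close>

text \<open>A sample of size \<open>n\<close> is given by the first \<open>n\<close> terms (indices \<open>0, \<dots>, n - 1\<close>) of sequences
  \<open>x\<close> and \<open>y\<close>.\<close>

definition rescaled_edf :: "nat \<Rightarrow> (nat \<Rightarrow> real) \<Rightarrow> real \<Rightarrow> real" where
  "rescaled_edf n x z = (\<Sum>i<n. of_bool (x i \<le> z)) / (real n + 1)"

definition nrank :: "nat \<Rightarrow> (nat \<Rightarrow> real) \<Rightarrow> nat \<Rightarrow> real" where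
  "nrank n x i = rescaled_edf n x (x i)"

definition nranks :: "nat \<Rightarrow> (nat \<Rightarrow> real) \<Rightarrow> (nat \<Rightarrow> real) \<Rightarrow> (real \<times> real) list" where
  "nranks n x y = map (\<lambda>i. (nrank n x i, nrank n y i)) [0..<n]"

definition xi :: "real \<Rightarrow> real \<Rightarrow> real \<Rightarrow> real" where
  "xi u v t = (if t = 0 then - ln u else if t = 1 then - ln v
               else min (- ln u / (1 - t)) (- ln v / t))"

definition An_P :: "nat \<Rightarrow> (nat \<Rightarrow> real) \<Rightarrow> (nat \<Rightarrow> real) \<Rightarrow> real \<Rightarrow> real" where
  "An_P n x y t = 1 / (1 / real n * (\<Sum>i<n. xi (nrank n x i) (nrank n y i) t))"

definition An_CFG :: "nat \<Rightarrow> (nat \<Rightarrow> real) \<Rightarrow> (nat \<Rightarrow> real) \<Rightarrow> real \<Rightarrow> real" where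
  "An_CFG n x y t =
     exp (- euler_mascheroni - 1 / real n * (\<Sum>i<n. ln (xi (nrank n x i) (nrank n y i) t)))"

definition empirical_copula :: "nat \<Rightarrow> (nat \<Rightarrow> real) \<Rightarrow> (nat \<Rightarrow> real) \<Rightarrow> real \<Rightarrow> real \<Rightarrow> real" where
  "empirical_copula n x y u v =
     1 / real n * (\<Sum>i<n. of_bool (nrank n x i \<le> u \<and> nrank n y i \<le> v))"

definition random_sample ::
  "'w measure \<Rightarrow> (nat \<Rightarrow> 'w \<Rightarrow> real) \<Rightarrow> (nat \<Rightarrow> 'w \<Rightarrow> real) \<Rightarrow> (real \<times> real) measure \<Rightarrow> bool" where
  "random_sample M X Y H \<longleftrightarrow>
     prob_space.indep_vars M (\<lambda>_. borel) (\<lambda>i \<omega>. (X i \<omega>, Y i \<omega>)) UNIV \<and>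
     (\<forall>i. distr M borel (\<lambda>\<omega>. (X i \<omega>, Y i \<omega>)) = H)"

text \<open>The limits, as functionals of a path of the limit of the empirical copula process.\<close>

definition lim_P :: "(real \<Rightarrow> real \<Rightarrow> real) \<Rightarrow> (real \<times> real \<Rightarrow> real) \<Rightarrow> real \<Rightarrow> real" where
  "lim_P C g t = - (A_P C t)\<^sup>2 * (LBINT x:{0<..<1}. g (x powr (1 - t), x powr t) / x)"

definition lim_CFG :: "(real \<Rightarrow> real \<Rightarrow> real) \<Rightarrow> (real \<times> real \<Rightarrow> real) \<Rightarrow> real \<Rightarrow> real" where
  "lim_CFG C g t = A_CFG C t * (LBINT x:{0<..<1}. g (x powr (1 - t), x powr t) / (x * ln x))"

section \<open>Regularity of a parametric family of functions on the unit interval\<close>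

definition twice_continuously_differentiable_on :: "real set \<Rightarrow> (real \<Rightarrow> real) \<Rightarrow> bool" where
  "twice_continuously_differentiable_on S f \<longleftrightarrow>
     (\<exists>f' f''. (\<forall>t\<in>S. (f has_real_derivative f' t) (at t)) \<and>
               (\<forall>t\<in>S. (f' has_real_derivative f'' t) (at t)) \<and> continuous_on S f'')"

text \<open>The suprema are taken in \<^typ>\<open>ereal\<close>, where they always exist.\<close>

definition regular_family ::
  "'a::euclidean_space set \<Rightarrow> ('a \<Rightarrow> real \<Rightarrow> real) \<Rightarrow> ('a \<Rightarrow> real \<Rightarrow> 'a) \<Rightarrow> bool" where
  "regular_family \<O> A A' \<longleftrightarrow>
     open \<O> \<and>
     (\<forall>\<theta>\<in>\<O>. twice_continuously_differentiable_on {0<..<1} (A \<theta>)) \<and>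
     (\<forall>\<theta>\<in>\<O>. \<forall>t\<in>{0..1}. GDERIV (\<lambda>\<theta>. A \<theta> t) \<theta> :> A' \<theta> t) \<and>
     (\<forall>\<theta>\<in>\<O>. ((\<lambda>\<epsilon>. SUP \<theta>'\<in>{\<theta>'\<in>\<O>. norm (\<theta>' - \<theta>) < \<epsilon>}. SUP t\<in>{0..1}.
                  ereal (norm (A' \<theta>' t - A' \<theta> t))) \<longlongrightarrow> 0) (at_right 0))"

end

(* The family A_theta is differentiable at theta_0 uniformly in t: condition (C) and the mean
   value inequality bound A_theta(t) - A_{theta_0}(t) - gradient(t) . (theta - theta_0) by
   o(|theta - theta_0|) uniformly in t.  As Theta_n is tight, sqrt n (A_n - A_{theta_n}) differs from
   g(sqrt n (A_n - A_{theta_0}), Theta_n), where g(f, w) = f - gradient . w, by a term that tends to 0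
   in probability, so the claim follows from the continuous mapping theorem and Slutsky's lemma.
   LTD gives uv <= C(u, v) <= min(u, v), hence integrable bounds under which A_C is continuous on
   [0,1]; rank-based estimators take finitely many values for fixed n, which gives measurability. *)

theory Submission
  imports Defs
begin

section \<open>Weak convergence in metric spaces\<close>

text \<open>Both claims are one delta method applied to two families of functions. The obstacle is
  the space: a limit in \<open>C_unit\<close> makes sense only if A_\<theta> and its gradient are
  continuous on all of [0,1]. But (B) speaks of the open interval, and (C) compares gradients at
  different parameters without saying how a gradient varies with t. Continuity of A_\<theta> up to
  the end points comes from dominated convergence in the defining integrals, and the gradient then
  inherits continuity from A_\<theta>. Moreover, \<open>weakly_converges\<close> asks every member
  of the sequence to be Borel measurable. For the plug-in process, which the estimator enters
  non-linearly, this is proved by freezing the estimator at each of its values.\<close>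

lemma space_borel_metric [simp]: "space (borel_metric m) = mspace m"
  unfolding borel_metric_def
  by (rule space_measure_of) (use openin_subset in fastforce)

lemma sets_borel_metric:
  "sets (borel_metric m) = sigma_sets (mspace m) {U. openin (mtopology_of m) U}"
  unfolding borel_metric_def
  by (rule sets_measure_of) (use openin_subset in fastforce)

lemma openin_sets_borel_metric: "openin (mtopology_of m) U \<Longrightarrow> U \<in> sets (borel_metric m)"
  by (simp add: sets_borel_metric sigma_sets.Basic)

lemma sets_borel_metric_euclidean [simp]: "sets (borel_metric euclidean_metric) = sets borel"
  by (simp add: sets_borel_metric borel_def Collect_mem_eq)

lemma measurable_borel_metric_continuous_map:
  assumes "continuous_map (mtopology_of m) (mtopology_of m') f"
  shows "f \<in> borel_metric m \<rightarrow>\<^sub>M borel_metric m'"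
  unfolding borel_metric_def[of m']
proof (rule measurable_measure_of)
  show "{U. openin (mtopology_of m') U} \<subseteq> Pow (mspace m')"
    using openin_subset by fastforce
  show "f \<in> space (borel_metric m) \<rightarrow> mspace m'"
    using continuous_map_image_subset_topspace[OF assms] by auto
  show "f -` U \<inter> space (borel_metric m) \<in> sets (borel_metric m)"
    if "U \<in> {U. openin (mtopology_of m') U}" for U
  proof -
    have "f -` U \<inter> space (borel_metric m) = {x \<in> topspace (mtopology_of m). f x \<in> U}"
      by auto
    then show ?thesis
      using openin_continuous_map_preimage[OF assms] that
      by (auto intro!: openin_sets_borel_metric)
  qed
qed

lemma borel_measurable_continuous_map_compose:
  fixes f :: "'a \<Rightarrow> 'b::metric_space"
  assumes "Z \<in> M \<rightarrow>\<^sub>M borel_metric m" "continuous_map (mtopology_of m) euclidean f"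
  shows "(\<lambda>\<omega>. f (Z \<omega>)) \<in> borel_measurable M"
proof -
  have "f \<in> borel_metric m \<rightarrow>\<^sub>M borel_metric euclidean_metric"
    by (rule measurable_borel_metric_continuous_map) (use assms(2) in simp)
  then have "f \<in> borel_measurable (borel_metric m)"
    using measurable_cong_sets[OF refl sets_borel_metric_euclidean] by blast
  with assms(1) show ?thesis by (rule measurable_compose)
qed

text \<open>Continuous mapping theorem: a test function composed with \<open>g\<close> is again a
  test function.\<close>

lemma weakly_converges_continuous_map:
  assumes W: "weakly_converges m M W N W0"
    and g: "continuous_map (mtopology_of m) (mtopology_of m') g"
  shows "weakly_converges m' M (\<lambda>n \<omega>. g (W n \<omega>)) N (\<lambda>\<omega>. g (W0 \<omega>))"
  unfolding weakly_converges_def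
proof (intro conjI allI impI)
  have gm: "g \<in> borel_metric m \<rightarrow>\<^sub>M borel_metric m'"
    by (rule measurable_borel_metric_continuous_map[OF g])
  show "(\<lambda>\<omega>. g (W n \<omega>)) \<in> M \<rightarrow>\<^sub>M borel_metric m'" for n
    using W gm unfolding weakly_converges_def by (blast intro: measurable_compose)
  show "(\<lambda>\<omega>. g (W0 \<omega>)) \<in> N \<rightarrow>\<^sub>M borel_metric m'"
    using W gm unfolding weakly_converges_def by (blast intro: measurable_compose)
  fix f assume f: "continuous_map (mtopology_of m') euclideanreal f \<and> bounded (f ` mspace m')"
  have "continuous_map (mtopology_of m) euclideanreal (f \<circ> g)"
    using continuous_map_compose[OF g] f by blast
  moreover have "bounded ((f \<circ> g) ` mspace m)"
    using f continuous_map_image_subset_topspace[OF g]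
    by (auto simp: image_comp[symmetric] intro: bounded_subset)
  ultimately show "(\<lambda>n. \<integral>\<omega>. f (g (W n \<omega>)) \<partial>M) \<longlonglongrightarrow> (\<integral>\<omega>. f (g (W0 \<omega>)) \<partial>N)"
    using W unfolding weakly_converges_def by (auto simp: o_def)
qed

text \<open>Lipschitz minorants increase to a bounded continuous function as \<open>k\<close> grows. They extend
  Slutsky's lemma from Lipschitz to bounded continuous test functions without tightness.\<close>

definition lipschitz_minorant :: "'a metric \<Rightarrow> ('a \<Rightarrow> real) \<Rightarrow> real \<Rightarrow> 'a \<Rightarrow> real" where
  "lipschitz_minorant m f k x = (INF y\<in>mspace m. f y + k * mdist m x y)"

context
  fixes m :: "'a metric" and f :: "'a \<Rightarrow> real" and B k :: real
  assumes f_bounded: "\<And>x. x \<in> mspace m \<Longrightarrow> \<bar>f x\<bar> \<le> B" and k_nonneg: "0 \<le> k"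
begin

lemma lipschitz_minorant_bdd: "bdd_below ((\<lambda>y. f y + k * mdist m x y) ` mspace m)"
proof (rule bdd_belowI2)
  fix y assume "y \<in> mspace m"
  moreover have "0 \<le> k * mdist m x y" using k_nonneg by simp
  ultimately show "- B \<le> f y + k * mdist m x y"
    using f_bounded[of y] by linarith
qed

lemma lipschitz_minorant_le: "x \<in> mspace m \<Longrightarrow> lipschitz_minorant m f k x \<le> f x"
  unfolding lipschitz_minorant_def
  using cINF_lower[OF lipschitz_minorant_bdd, of x x]
  by (simp add: Metric_space.mdist_zero[OF Metric_space_mspace_mdist])

lemma lipschitz_minorant_ge: "x \<in> mspace m \<Longrightarrow> - B \<le> lipschitz_minorant m f k x"
  unfolding lipschitz_minorant_def
proof (intro cINF_greatest)
  fix y assume "y \<in> mspace m"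
  moreover have "0 \<le> k * mdist m x y" using k_nonneg by simp
  ultimately show "- B \<le> f y + k * mdist m x y"
    using f_bounded[of y] by linarith
qed auto

lemma lipschitz_minorant_abs_le: "x \<in> mspace m \<Longrightarrow> \<bar>lipschitz_minorant m f k x\<bar> \<le> B"
  using lipschitz_minorant_ge lipschitz_minorant_le f_bounded by (smt (verit))

text \<open>As a function of \<open>x\<close>, each competitor \<open>f y + k * mdist m x y\<close>
  grows by at most \<open>k\<close> times the distance moved, and an infimum keeps this one-sided
  bound. Exchanging the points gives the Lipschitz condition.\<close>

lemma lipschitz_minorant_diff_le:
  assumes "x \<in> mspace m" "x' \<in> mspace m"
  shows "lipschitz_minorant m f k x \<le> lipschitz_minorant m f k x' + k * mdist m x x'"
proof -
  have "lipschitz_minorant m f k x - k * mdist m x x' \<le> f y + k * mdist m x' y"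
    if y: "y \<in> mspace m" for y
  proof -
    have "lipschitz_minorant m f k x \<le> f y + k * mdist m x y"
      unfolding lipschitz_minorant_def by (rule cINF_lower[OF lipschitz_minorant_bdd y])
    also have "\<dots> \<le> f y + k * (mdist m x x' + mdist m x' y)"
      using assms y k_nonneg by (intro add_left_mono mult_left_mono mdist_triangle) auto
    finally show ?thesis by (simp add: algebra_simps)
  qed
  then have "lipschitz_minorant m f k x - k * mdist m x x' \<le> lipschitz_minorant m f k x'"
    unfolding lipschitz_minorant_def[of m f k x'] using assms by (intro cINF_greatest) auto
  then show ?thesis by simp
qed

lemma continuous_map_lipschitz_minorant:
  "continuous_map (mtopology_of m) euclideanreal (lipschitz_minorant m f k)"
proof -
  have "Lipschitz_continuous_map m euclidean_metric (lipschitz_minorant m f k)"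
    unfolding Lipschitz_continuous_map_def
  proof (intro conjI exI[of _ k] ballI)
    fix x y assume xy: "x \<in> mspace m" "y \<in> mspace m"
    show "mdist euclidean_metric (lipschitz_minorant m f k x) (lipschitz_minorant m f k y)
      \<le> k * mdist m x y"
      using lipschitz_minorant_diff_le[OF xy] lipschitz_minorant_diff_le[OF xy(2,1)]
      by (simp add: dist_real_def mdist_commute[of m y x] abs_le_iff)
  qed auto
  then show ?thesis
    using Lipschitz_continuous_imp_continuous_map by fastforce
qed

end

text \<open>Near \<open>x\<close>, continuity keeps \<open>f y\<close> above
  \<open>f x - e / 2\<close>; at distance \<delta> or more, the penalty exceeds 2 B, the largest
  possible oscillation of \<open>f\<close>, once \<open>k\<close> is large.\<close>

lemma lipschitz_minorant_tendsto:
  assumes cont: "continuous_map (mtopology_of m) euclideanreal f"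
    and B: "\<And>x. x \<in> mspace m \<Longrightarrow> \<bar>f x\<bar> \<le> B"
    and x: "x \<in> mspace m"
  shows "(\<lambda>k. lipschitz_minorant m f (real k) x) \<longlonglongrightarrow> f x"
proof (rule LIMSEQ_I)
  fix e :: real assume e: "0 < e"
  obtain \<delta> where \<delta>: "\<delta> > 0"
    and f\<delta>: "\<And>y. y \<in> mspace m \<Longrightarrow> mdist m x y < \<delta> \<Longrightarrow> \<bar>f y - f x\<bar> < e / 2"
  proof -
    have "\<exists>\<delta>>0. \<forall>y. y \<in> mspace m \<and> mdist m x y < \<delta> \<longrightarrow> dist (f x) (f y) < e / 2"
      using cont x half_gt_zero[OF e]
        Metric_space.metric_continuous_map[OF Metric_space_mspace_mdist[of m]
          Metric_space_mspace_mdist[of "euclidean_metric :: real metric"], of f]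
      by (metis mtopology_of_def mtopology_of_euclidean mdist_euclidean_metric mspace_euclidean_metric)
    then show ?thesis using that by (auto simp: dist_real_def abs_minus_commute)
  qed
  obtain k0 :: nat where k0: "2 * B / \<delta> \<le> real k0" using real_arch_simple by blast
  show "\<exists>n0. \<forall>k\<ge>n0. norm (lipschitz_minorant m f (real k) x - f x) < e"
  proof (intro exI[of _ k0] allI impI)
    fix k assume "k0 \<le> k"
    then have k: "2 * B \<le> real k * \<delta>"
      using k0 \<delta> by (simp add: field_simps) (smt (verit) mult_left_mono of_nat_mono)
    have "f x - e / 2 \<le> lipschitz_minorant m f (real k) x"
      unfolding lipschitz_minorant_def
    proof (rule cINF_greatest)
      fix y assume y: "y \<in> mspace m"
      show "f x - e / 2 \<le> f y + real k * mdist m x y"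
      proof (cases "mdist m x y < \<delta>")
        case True
        moreover have "0 \<le> real k * mdist m x y" by simp
        ultimately show ?thesis using f\<delta>[OF y] by linarith
      next
        case False
        then have "real k * \<delta> \<le> real k * mdist m x y" by (intro mult_left_mono) auto
        then show ?thesis using k B[OF y] B[OF x] e by linarith
      qed
    qed (use x in auto)
    moreover have "lipschitz_minorant m f (real k) x \<le> f x"
      using B x by (intro lipschitz_minorant_le) auto
    ultimately show "norm (lipschitz_minorant m f (real k) x - f x) < e"
      using e by simp
  qed
qed

section \<open>Slutsky's lemma\<close>

lemma converging_together_lower:
  assumes M: "prob_space M" and N: "prob_space N"
    and W: "weakly_converges m M W N W0"
    and Z: "\<And>n. Z n \<in> M \<rightarrow>\<^sub>M borel_metric m"
    and close: "\<And>e. e > 0 \<Longrightarrow> \<forall>\<^sub>F n in sequentially. \<exists>E\<in>sets M. measure M E \<le> e \<and>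
                  (\<forall>\<omega>\<in>space M - E. mdist m (W n \<omega>) (Z n \<omega>) \<le> e)"
    and f: "continuous_map (mtopology_of m) euclideanreal f" "bounded (f ` mspace m)"
    and e: "e > 0"
  shows "\<forall>\<^sub>F n in sequentially. (\<integral>\<omega>. f (W0 \<omega>) \<partial>N) - e < (\<integral>\<omega>. f (Z n \<omega>) \<partial>M)"
proof -
  interpret M: prob_space M by (rule M)
  interpret N: prob_space N by (rule N)
  obtain B where B: "B > 0" "\<And>x. x \<in> mspace m \<Longrightarrow> \<bar>f x\<bar> \<le> B"
    using f(2) by (auto simp: bounded_pos)
  have Wm: "W n \<in> M \<rightarrow>\<^sub>M borel_metric m" and W0m: "W0 \<in> N \<rightarrow>\<^sub>M borel_metric m" for n
    using W by (auto simp: weakly_converges_def)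
  have sp: "\<omega> \<in> space M \<Longrightarrow> W n \<omega> \<in> mspace m" "\<omega> \<in> space M \<Longrightarrow> Z n \<omega> \<in> mspace m"
    "\<omega>' \<in> space N \<Longrightarrow> W0 \<omega>' \<in> mspace m" for \<omega> \<omega>' n
    using measurable_space[OF Wm] measurable_space[OF Z] measurable_space[OF W0m] by auto
  let ?g = "\<lambda>k. lipschitz_minorant m f (real k)"
  have g_cont: "continuous_map (mtopology_of m) euclideanreal (?g k)" for k
    using B by (intro continuous_map_lipschitz_minorant) auto
  have g_abs: "\<bar>?g k x\<bar> \<le> B" if "x \<in> mspace m" for k x
    using B that by (intro lipschitz_minorant_abs_le) auto
  note meas = borel_measurable_continuous_map_compose[OF _ g_cont]
    borel_measurable_continuous_map_compose[OF _ f(1)]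
  \<comment> \<open>The index \<open>k\<close> is fixed here from the limit law alone, before
    \<open>n\<close> and the exceptional set are chosen.\<close>
  have "(\<lambda>k. \<integral>\<omega>. ?g k (W0 \<omega>) \<partial>N) \<longlonglongrightarrow> (\<integral>\<omega>. f (W0 \<omega>) \<partial>N)"
    by (rule integral_dominated_convergence[where w = "\<lambda>_. B"])
      (auto intro!: meas W0m AE_I2 lipschitz_minorant_tendsto[OF f(1) B(2)] g_abs sp)
  then have "\<forall>\<^sub>F k in sequentially. (\<integral>\<omega>. f (W0 \<omega>) \<partial>N) - e / 3 < (\<integral>\<omega>. ?g k (W0 \<omega>) \<partial>N)"
    using e by (intro order_tendstoD(1)) auto
  then obtain k where k: "(\<integral>\<omega>. f (W0 \<omega>) \<partial>N) - e / 3 < (\<integral>\<omega>. ?g k (W0 \<omega>) \<partial>N)"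
    using eventually_happens'[OF sequentially_bot] by blast
  have "bounded (?g k ` mspace m)"
    by (rule boundedI[of _ B]) (auto intro: g_abs)
  then have "(\<lambda>n. \<integral>\<omega>. ?g k (W n \<omega>) \<partial>M) \<longlonglongrightarrow> (\<integral>\<omega>. ?g k (W0 \<omega>) \<partial>N)"
    using W g_cont[of k] by (simp add: weakly_converges_def)
  then have ev1: "\<forall>\<^sub>F n in sequentially. (\<integral>\<omega>. ?g k (W0 \<omega>) \<partial>N) - e / 3 < (\<integral>\<omega>. ?g k (W n \<omega>) \<partial>M)"
    using e by (intro order_tendstoD(1)) auto
  \<comment> \<open>One third of \<open>e\<close> pays for the passage from \<open>f\<close> to the
    minorant, one third for the convergence of its integrals; \<open>d\<close> makes the losses off
    and on \<open>E\<close> add up to the last third. \<open>B > 0\<close> keeps the denominator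
    positive when \<open>k = 0\<close>.\<close>
  define d where "d = e / (3 * (real k + 2 * B))"
  have d: "d > 0" "real k * d + 2 * B * d = e / 3"
  proof -
    have pos: "real k + 2 * B > 0" using B(1) by simp
    then show "d > 0" using e by (simp add: d_def)
    have "(real k + 2 * B) * d = e / 3"
      unfolding d_def using pos by (metis less_irrefl mult.commute nonzero_divide_mult_cancel_left
        divide_divide_eq_left times_divide_eq_right nonzero_mult_div_cancel_left)
    then show "real k * d + 2 * B * d = e / 3" by (simp add: algebra_simps)
  qed
  show ?thesis
    using ev1 close[OF d(1)]
  proof eventually_elim
    case (elim n)
    then obtain E where E: "E \<in> sets M" "measure M E \<le> d"
      "\<And>\<omega>. \<omega> \<in> space M - E \<Longrightarrow> mdist m (W n \<omega>) (Z n \<omega>) \<le> d" by auto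
    have iW: "integrable M (\<lambda>\<omega>. ?g k (W n \<omega>))"
      by (rule M.integrable_const_bound[of _ B]) (auto intro!: AE_I2 meas Wm g_abs sp)
    have iZ: "integrable M (\<lambda>\<omega>. f (Z n \<omega>))"
      by (rule M.integrable_const_bound[of _ B]) (auto intro!: AE_I2 meas Z B(2) sp)
    have iE: "integrable M (indicator E :: _ \<Rightarrow> real)"
      by (rule M.integrable_const_bound[of _ 1]) (use E(1) in auto)
    have "(\<integral>\<omega>. ?g k (W n \<omega>) - real k * d - 2 * B * indicator E \<omega> \<partial>M) \<le> (\<integral>\<omega>. f (Z n \<omega>) \<partial>M)"
    proof (rule integral_mono)
      show "integrable M (\<lambda>\<omega>. ?g k (W n \<omega>) - real k * d - 2 * B * indicator E \<omega>)"
        using iW iE by (intro Bochner_Integration.integrable_diff integrable_mult_right) auto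
      fix \<omega> assume w: "\<omega> \<in> space M"
      show "?g k (W n \<omega>) - real k * d - 2 * B * indicator E \<omega> \<le> f (Z n \<omega>)"
      proof (cases "\<omega> \<in> E")
        case True
        have "0 \<le> real k * d" using d by simp
        then show ?thesis
          using True B(2)[OF sp(2)[OF w, of n]] g_abs[OF sp(1)[OF w, of n], of k] by simp
      next
        case False
        have "?g k (W n \<omega>) \<le> ?g k (Z n \<omega>) + real k * mdist m (W n \<omega>) (Z n \<omega>)"
          using B w by (intro lipschitz_minorant_diff_le) (auto simp: sp)
        also have "?g k (Z n \<omega>) \<le> f (Z n \<omega>)"
          using B w by (intro lipschitz_minorant_le) (auto simp: sp)
        also have "real k * mdist m (W n \<omega>) (Z n \<omega>) \<le> real k * d"
          using E(3) w False by (intro mult_left_mono) auto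
        finally show ?thesis using False by simp
      qed
    qed (rule iZ)
    also have "(\<integral>\<omega>. ?g k (W n \<omega>) - real k * d - 2 * B * indicator E \<omega> \<partial>M)
      = (\<integral>\<omega>. ?g k (W n \<omega>) \<partial>M) - real k * d - 2 * B * measure M E"
      using iW iE E(1) by (simp add: M.prob_space)
    finally have "(\<integral>\<omega>. ?g k (W n \<omega>) \<partial>M) - real k * d - 2 * B * measure M E
      \<le> (\<integral>\<omega>. f (Z n \<omega>) \<partial>M)" .
    moreover have "2 * B * measure M E \<le> 2 * B * d" using B E by simp
    ultimately show ?case using elim(1) k d(2) by linarith
  qed
qed

text \<open>Minorants bound the integrals only from below. As \<open>close\<close> does not involve
  \<open>f\<close>, the same bound for \<open>- f\<close> gives the other half.\<close>

lemma weakly_converges_converging_together: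
  assumes M: "prob_space M" and N: "prob_space N"
    and W: "weakly_converges m M W N W0"
    and Z: "\<And>n. Z n \<in> M \<rightarrow>\<^sub>M borel_metric m"
    and close: "\<And>e. e > 0 \<Longrightarrow> \<forall>\<^sub>F n in sequentially. \<exists>E\<in>sets M. measure M E \<le> e \<and>
                  (\<forall>\<omega>\<in>space M - E. mdist m (W n \<omega>) (Z n \<omega>) \<le> e)"
  shows "weakly_converges m M Z N W0"
  unfolding weakly_converges_def
proof (intro conjI allI impI Z)
  show "W0 \<in> N \<rightarrow>\<^sub>M borel_metric m" using W by (simp add: weakly_converges_def)
  fix f assume f: "continuous_map (mtopology_of m) euclideanreal f \<and> bounded (f ` mspace m)"
  have f': "continuous_map (mtopology_of m) euclideanreal (\<lambda>x. - f x)"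
      "bounded ((\<lambda>x. - f x) ` mspace m)"
    using f by (auto intro: continuous_map_minus simp: bounded_iff)
  show "(\<lambda>n. \<integral>\<omega>. f (Z n \<omega>) \<partial>M) \<longlonglongrightarrow> (\<integral>\<omega>. f (W0 \<omega>) \<partial>N)"
  proof (rule tendstoI)
    fix e :: real assume e: "e > 0"
    have "\<forall>\<^sub>F n in sequentially. (\<integral>\<omega>. f (W0 \<omega>) \<partial>N) - e < (\<integral>\<omega>. f (Z n \<omega>) \<partial>M)"
      using f e by (intro converging_together_lower[OF M N W Z close]) auto
    moreover have "\<forall>\<^sub>F n in sequentially. (\<integral>\<omega>. - f (W0 \<omega>) \<partial>N) - e < (\<integral>\<omega>. - f (Z n \<omega>) \<partial>M)"
      by (intro converging_together_lower[OF M N W Z close f' e])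
    ultimately show "\<forall>\<^sub>F n in sequentially. dist (\<integral>\<omega>. f (Z n \<omega>) \<partial>M) (\<integral>\<omega>. f (W0 \<omega>) \<partial>N) < e"
      by eventually_elim (auto simp: dist_real_def abs_less_iff)
  qed
qed

section \<open>The space of continuous functions, and tightness\<close>

lemma mspace_C_unit: "mspace C_unit = {f \<in> extensional {0..1}. continuous_on {0..1} f}"
  \<comment> \<open>\<open>cfunspace\<close> consists of bounded continuous functions; on the
    compact interval boundedness is automatic.\<close>
  unfolding C_unit_def by (subst compactin_mspace_cfunspace) (auto simp: )

lemma restrict_mem_C_unit: "continuous_on {0..1} f \<Longrightarrow> restrict f {0..1} \<in> mspace C_unit"
  unfolding mspace_C_unit by (auto intro: continuous_on_eq)

lemma mdist_C_unit_le:
  assumes "f \<in> mspace C_unit" "g \<in> mspace C_unit"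
  shows "mdist C_unit f g \<le> a \<longleftrightarrow> (\<forall>t\<in>{0..1}. \<bar>f t - g t\<bar> \<le> a)"
  using assms unfolding C_unit_def
  by (subst cfunspace_mdist_le) (auto simp: dist_real_def)

text \<open>The indicator of a large norm is not a test function, so the ramp
  \<open>\<psi> K\<close>, which is 0 up to norm \<open>K\<close> and 1 from \<open>K + 1\<close>
  on, replaces it. Its mean under the limit law is small for large \<open>K\<close>, and weak
  convergence carries this over to \<open>V n\<close> for large \<open>n\<close>.\<close>

lemma weakly_converges_tight:
  fixes V :: "nat \<Rightarrow> 'w \<Rightarrow> 'a::euclidean_space"
  assumes M: "prob_space M" and N: "prob_space N"
    and V: "weakly_converges euclidean_metric M V N V0" and e: "e > 0"
  obtains K where "K > 0"
    "\<forall>\<^sub>F n in sequentially. measure M {\<omega> \<in> space M. norm (V n \<omega>) > K} \<le> e"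
proof -
  interpret M: prob_space M by (rule M)
  interpret N: prob_space N by (rule N)
  define \<psi> where "\<psi> = (\<lambda>K (x::'a). min 1 (max 0 (norm x - K)))"
  have cont: "continuous_on UNIV (\<psi> K)" for K
    unfolding \<psi>_def by (intro continuous_intros)
  have Vm: "V n \<in> borel_measurable M" and V0m: "V0 \<in> borel_measurable N" for n
    using V borel_measurable_continuous_map_compose[of _ _ euclidean_metric "\<lambda>x. x"]
    by (auto simp: weakly_converges_def)
  have \<psi>m: "\<psi> K \<in> borel_measurable borel" for K
    using cont by (rule borel_measurable_continuous_onI)
  have \<psi>_bound: "\<bar>\<psi> K x\<bar> \<le> 1" "0 \<le> \<psi> K x" for K x by (auto simp: \<psi>_def)
  have "(\<lambda>j. \<integral>\<omega>. \<psi> (real j) (V0 \<omega>) \<partial>N) \<longlonglongrightarrow> (\<integral>\<omega>. 0 \<partial>N)"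
  proof (rule integral_dominated_convergence[where w = "\<lambda>_. 1"])
    show "AE \<omega> in N. (\<lambda>j. \<psi> (real j) (V0 \<omega>)) \<longlonglongrightarrow> 0"
    proof (rule AE_I2, rule tendsto_eventually)
      fix \<omega>
      show "\<forall>\<^sub>F j in sequentially. \<psi> (real j) (V0 \<omega>) = 0"
        using eventually_ge_at_top[of "nat \<lceil>norm (V0 \<omega>)\<rceil>"]
      proof eventually_elim
        case (elim j)
        then have "norm (V0 \<omega>) \<le> real j" by linarith
        then show ?case by (simp add: \<psi>_def)
      qed
    qed
  qed (use measurable_compose[OF V0m \<psi>m] \<psi>_bound in auto)
  then have "\<forall>\<^sub>F j in sequentially. (\<integral>\<omega>. \<psi> (real j) (V0 \<omega>) \<partial>N) < e"
    using e by (intro order_tendstoD(2)) auto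
  then obtain j where j: "(\<integral>\<omega>. \<psi> (real j) (V0 \<omega>) \<partial>N) < e"
    using eventually_happens'[OF sequentially_bot] by blast
  have "bounded (range (\<psi> (real j)))"
    by (rule boundedI[of _ 1]) (use \<psi>_bound in auto)
  then have "(\<lambda>n. \<integral>\<omega>. \<psi> (real j) (V n \<omega>) \<partial>M) \<longlonglongrightarrow> (\<integral>\<omega>. \<psi> (real j) (V0 \<omega>) \<partial>N)"
    using V cont[of "real j"] by (auto simp: weakly_converges_def)
  then have "\<forall>\<^sub>F n in sequentially. (\<integral>\<omega>. \<psi> (real j) (V n \<omega>) \<partial>M) < e"
    using j by (rule order_tendstoD(2))
  then have "\<forall>\<^sub>F n in sequentially. measure M {\<omega> \<in> space M. norm (V n \<omega>) > real j + 1} \<le> e"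
  proof eventually_elim
    case (elim n)
    let ?E = "{\<omega> \<in> space M. norm (V n \<omega>) > real j + 1}"
    have E: "?E \<in> sets M" using Vm[of n] by measurable
    have "measure M ?E = (\<integral>\<omega>. indicator ?E \<omega> \<partial>M)" using E by simp
    also have "\<dots> \<le> (\<integral>\<omega>. \<psi> (real j) (V n \<omega>) \<partial>M)"
    proof (rule integral_mono)
      show "integrable M (\<lambda>\<omega>. \<psi> (real j) (V n \<omega>))"
        by (rule M.integrable_const_bound[of _ 1])
          (use measurable_compose[OF Vm \<psi>m] \<psi>_bound in auto)
      show "indicator ?E \<omega> \<le> \<psi> (real j) (V n \<omega>)" for \<omega>
        using \<psi>_bound(2) by (auto simp: indicator_def) (auto simp: \<psi>_def)
      show "integrable M (indicator ?E :: _ \<Rightarrow> real)"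
        by (rule M.integrable_const_bound[of _ 1]) (use E in auto)
    qed
    finally show ?case using elim by simp
  qed
  then show thesis by (intro that[of "real j + 1"]) auto
qed

section \<open>The delta method in the space of continuous functions\<close>

text \<open>Epsilon-delta form of (C). Openness of \<O> shrinks the radius until the whole ball lies
  in \<O>, so that gradients exist at all its points.\<close>

lemma regular_family_gradient_uniform:
  assumes R: "regular_family \<O> A A'" and \<eta>: "\<eta> \<in> \<O>" and e: "e > 0"
  obtains \<delta> where "\<delta> > 0" "\<And>\<eta>'. norm (\<eta>' - \<eta>) < \<delta> \<Longrightarrow> \<eta>' \<in> \<O>"
    "\<And>\<eta>' t. norm (\<eta>' - \<eta>) < \<delta> \<Longrightarrow> t \<in> {0..1} \<Longrightarrow> norm (A' \<eta>' t - A' \<eta> t) \<le> e"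
proof -
  let ?S = "\<lambda>\<epsilon>. SUP \<theta>'\<in>{\<theta>'\<in>\<O>. norm (\<theta>' - \<eta>) < \<epsilon>}. SUP t\<in>{0..1}.
                  ereal (norm (A' \<theta>' t - A' \<eta> t))"
  have "(?S \<longlongrightarrow> 0) (at_right 0)" using R \<eta> by (auto simp: regular_family_def)
  then have "\<forall>\<^sub>F \<epsilon> in at_right 0. ?S \<epsilon> < ereal e"
    using e by (intro order_tendstoD(2)) auto
  then obtain b where b: "b > 0" "\<And>\<epsilon>. 0 < \<epsilon> \<Longrightarrow> \<epsilon> < b \<Longrightarrow> ?S \<epsilon> < ereal e"
    unfolding eventually_at_right_field by blast
  obtain r where r: "r > 0" "ball \<eta> r \<subseteq> \<O>"
    using R \<eta> open_contains_ball[of \<O>] by (auto simp: regular_family_def)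
  \<comment> \<open>Halving \<open>b\<close> gives \<open>\<delta> < b\<close> strictly, so that the
    supremum can be evaluated at \<delta> itself.\<close>
  define \<delta> where "\<delta> = min (b / 2) r"
  have \<delta>: "\<delta> > 0" "\<delta> < b" using b(1) r(1) by (auto simp: \<delta>_def)
  have mem: "\<eta>' \<in> \<O>" if "norm (\<eta>' - \<eta>) < \<delta>" for \<eta>'
    using that r(2) by (auto simp: \<delta>_def dist_norm norm_minus_commute)
  have "norm (A' \<eta>' t - A' \<eta> t) \<le> e" if h: "norm (\<eta>' - \<eta>) < \<delta>" "t \<in> {0..1}" for \<eta>' t
  proof -
    have "ereal (norm (A' \<eta>' t - A' \<eta> t)) \<le> (SUP t\<in>{0..1}. ereal (norm (A' \<eta>' t - A' \<eta> t)))"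
      using h(2) by (rule SUP_upper)
    also have "\<dots> \<le> ?S \<delta>"
      using h(1) mem[OF h(1)] by (intro SUP_upper) auto
    also have "\<dots> < ereal e" using b(2) \<delta> by blast
    finally show ?thesis by simp
  qed
  with \<delta> mem show thesis by (intro that) auto
qed

text \<open>Mean value inequality for \<open>A z t\<close> minus the linear function with gradient
  \<open>A' \<eta> t\<close>: the difference has gradient \<open>A' z t - A' \<eta> t\<close>, which
  is small on a ball whose radius does not depend on \<open>t\<close>.\<close>

lemma regular_family_expansion:
  assumes R: "regular_family \<O> A A'" and \<eta>: "\<eta> \<in> \<O>" and e: "e > 0"
  obtains \<delta> where "\<delta> > 0" "\<And>\<eta>'. norm (\<eta>' - \<eta>) < \<delta> \<Longrightarrow> \<eta>' \<in> \<O>"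
    "\<And>\<eta>' t. norm (\<eta>' - \<eta>) < \<delta> \<Longrightarrow> t \<in> {0..1} \<Longrightarrow>
       \<bar>A \<eta>' t - A \<eta> t - A' \<eta> t \<bullet> (\<eta>' - \<eta>)\<bar> \<le> e * norm (\<eta>' - \<eta>)"
proof -
  obtain \<delta> where \<delta>: "\<delta> > 0" "\<And>\<eta>'. norm (\<eta>' - \<eta>) < \<delta> \<Longrightarrow> \<eta>' \<in> \<O>"
    "\<And>\<eta>' t. norm (\<eta>' - \<eta>) < \<delta> \<Longrightarrow> t \<in> {0..1} \<Longrightarrow> norm (A' \<eta>' t - A' \<eta> t) \<le> e"
    using regular_family_gradient_uniform[OF assms] by blast
  have "\<bar>A \<eta>' t - A \<eta> t - A' \<eta> t \<bullet> (\<eta>' - \<eta>)\<bar> \<le> e * norm (\<eta>' - \<eta>)"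
    if h: "norm (\<eta>' - \<eta>) < \<delta>" and t: "t \<in> {0..1}" for \<eta>' t
  proof -
    let ?r = "\<lambda>z. A z t - A' \<eta> t \<bullet> z"
    have "norm (?r \<eta>' - ?r \<eta>) \<le> e * norm (\<eta>' - \<eta>)"
    proof (rule differentiable_bound)
      show "convex (ball \<eta> \<delta>)" by simp
      fix z assume z: "z \<in> ball \<eta> \<delta>"
      then have zn: "norm (z - \<eta>) < \<delta>" by (simp add: dist_norm norm_minus_commute)
      have "GDERIV (\<lambda>\<theta>. A \<theta> t) z :> A' z t"
        using R \<delta>(2)[OF zn] t by (auto simp: regular_family_def)
      then have "((\<lambda>\<theta>. A \<theta> t) has_derivative (\<lambda>h. h \<bullet> A' z t)) (at z within ball \<eta> \<delta>)"
        unfolding gderiv_def by (rule has_derivative_at_withinI)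
      then show "(?r has_derivative (\<lambda>h. h \<bullet> A' z t - A' \<eta> t \<bullet> h)) (at z within ball \<eta> \<delta>)"
        by (auto intro!: derivative_eq_intros)
      show "onorm (\<lambda>h. h \<bullet> A' z t - A' \<eta> t \<bullet> h) \<le> e"
      proof (rule onorm_le)
        fix h
        have "h \<bullet> A' z t - A' \<eta> t \<bullet> h = (A' z t - A' \<eta> t) \<bullet> h"
          by (simp add: inner_diff_left inner_diff_right inner_commute)
        also have "norm \<dots> \<le> norm (A' z t - A' \<eta> t) * norm h"
          by (simp add: Cauchy_Schwarz_ineq2)
        also have "\<dots> \<le> e * norm h"
          using \<delta>(3)[OF zn t] by (intro mult_right_mono) auto
        finally show "norm (h \<bullet> A' z t - A' \<eta> t \<bullet> h) \<le> e * norm h" .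
      qed
    qed (use h \<delta>(1) in \<open>auto simp: dist_norm norm_minus_commute\<close>)
    then show ?thesis by (simp add: inner_diff_right algebra_simps)
  qed
  with \<delta> show thesis by (intro that) auto
qed

text \<open>The gradient is a limit of difference quotients, uniformly in the argument.\<close>

lemma regular_family_gradient_continuous:
  assumes R: "regular_family \<O> A A'" and \<eta>: "\<eta> \<in> \<O>"
    and A: "\<And>\<eta>. \<eta> \<in> \<O> \<Longrightarrow> continuous_on {0..1} (A \<eta>)"
  shows "continuous_on {0..1} (A' \<eta>)"
proof (rule continuous_on_componentwise[THEN iffD2], rule ballI)
  fix h :: 'a assume "h \<in> Basis"
  then have h: "norm h = 1" by simp
  define q where "q = (\<lambda>s t. (A (\<eta> + s *\<^sub>R h) t - A \<eta> t) / s)"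
  show "continuous_on {0..1} (\<lambda>t. A' \<eta> t \<bullet> h)"
  proof (rule uniform_limit_theorem)
    obtain \<delta> where \<delta>: "\<delta> > 0" "\<And>\<eta>'. norm (\<eta>' - \<eta>) < \<delta> \<Longrightarrow> \<eta>' \<in> \<O>"
      by (rule regular_family_gradient_uniform[OF R \<eta> zero_less_one], rule that)
    \<comment> \<open>As \<open>h\<close> has norm 1, the shifted parameter stays within \<delta> of
      \<eta>, hence in \<O>, where \<open>A\<close> is continuous in \<open>t\<close>.\<close>
    have "\<forall>\<^sub>F s in at_right 0. 0 < s \<and> s < \<delta>"
      using \<delta>(1) eventually_at_right_field by blast
    then show "\<forall>\<^sub>F s in at_right 0. continuous_on {0..1} (q s)"
    proof eventually_elim
      case (elim s)
      then have "\<eta> + s *\<^sub>R h \<in> \<O>" using h by (intro \<delta>(2)) auto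
      then show ?case
        unfolding q_def using A \<eta> elim by (intro continuous_intros) auto
    qed
    show "uniform_limit {0..1} q (\<lambda>t. A' \<eta> t \<bullet> h) (at_right 0)"
    proof (rule uniform_limitI)
      fix e :: real assume "e > 0"
      then obtain \<delta> where \<delta>: "\<delta> > 0"
        "\<And>\<eta>' t. norm (\<eta>' - \<eta>) < \<delta> \<Longrightarrow> t \<in> {0..1} \<Longrightarrow>
           \<bar>A \<eta>' t - A \<eta> t - A' \<eta> t \<bullet> (\<eta>' - \<eta>)\<bar> \<le> e / 2 * norm (\<eta>' - \<eta>)"
        using regular_family_expansion[OF R \<eta>, of "e / 2"] by (metis half_gt_zero)
      have "\<forall>\<^sub>F s in at_right 0. 0 < s \<and> s < \<delta>"
        using \<delta>(1) eventually_at_right_field by blast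
      then show "\<forall>\<^sub>F s in at_right 0. \<forall>t\<in>{0..1}. dist (q s t) (A' \<eta> t \<bullet> h) < e"
      proof eventually_elim
        case (elim s)
        show ?case
        proof
          fix t :: real assume "t \<in> {0..1}"
          with \<delta>(2)[of "\<eta> + s *\<^sub>R h" t] elim h
          have "\<bar>A (\<eta> + s *\<^sub>R h) t - A \<eta> t - s * (A' \<eta> t \<bullet> h)\<bar> \<le> e / 2 * s" by simp
          then have "\<bar>A (\<eta> + s *\<^sub>R h) t - A \<eta> t - s * (A' \<eta> t \<bullet> h)\<bar> / s \<le> e / 2"
            using elim by (simp add: pos_divide_le_eq)
          moreover have "q s t - A' \<eta> t \<bullet> h = (A (\<eta> + s *\<^sub>R h) t - A \<eta> t - s * (A' \<eta> t \<bullet> h)) / s"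
            using elim by (simp add: q_def field_simps)
          ultimately have "\<bar>q s t - A' \<eta> t \<bullet> h\<bar> \<le> e / 2"
            using elim by simp
          then show "dist (q s t) (A' \<eta> t \<bullet> h) < e"
            using \<open>e > 0\<close> by (simp add: dist_real_def)
        qed
      qed
    qed
  qed simp
qed

section \<open>The limit map and the delta method\<close>

text \<open>\<open>D\<close> is bounded by some \<open>K\<close> on the compact interval, so the map
  is Lipschitz with constant \<open>1 + K\<close>: 1 from the path and \<open>K\<close>, by
  Cauchy-Schwarz, from the vector.\<close>

lemma continuous_map_C_unit_sub_inner:
  fixes D :: "real \<Rightarrow> 'a::euclidean_space"
  assumes D: "continuous_on {0..1} D"
  shows "continuous_map (mtopology_of (prod_metric C_unit euclidean_metric)) (mtopology_of C_unit)
           (\<lambda>p. \<lambda>t\<in>{0..1}. fst p t - D t \<bullet> snd p)" (is "continuous_map _ _ ?g")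
proof (rule Lipschitz_continuous_imp_continuous_map)
  have "bounded (D ` {0..1})"
    by (intro compact_imp_bounded compact_continuous_image D compact_Icc)
  then obtain K where K: "K > 0" "\<And>t. t \<in> {0..1} \<Longrightarrow> norm (D t) \<le> K"
    by (auto simp: bounded_pos)
  have g: "?g p \<in> mspace C_unit" if "fst p \<in> mspace C_unit" for p
    using that by (intro restrict_mem_C_unit continuous_intros D) (simp add: mspace_C_unit)
  show "Lipschitz_continuous_map (prod_metric C_unit euclidean_metric) C_unit ?g"
    unfolding Lipschitz_continuous_map_def
  proof (intro conjI exI[of _ "1 + K"] ballI)
    show "?g \<in> mspace (prod_metric C_unit euclidean_metric) \<rightarrow> mspace C_unit"
      using g by auto
    fix p q :: "(real \<Rightarrow> real) \<times> 'a"
    assume pq: "p \<in> mspace (prod_metric C_unit euclidean_metric)"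
      "q \<in> mspace (prod_metric C_unit euclidean_metric)"
    let ?d = "mdist (prod_metric C_unit euclidean_metric) p q"
    have d: "mdist C_unit (fst p) (fst q) \<le> ?d" "norm (snd p - snd q) \<le> ?d"
      using Metric_space12.component_le_prod_metric[OF
          Metric_space12_mspace_mdist[of C_unit "euclidean_metric :: 'a metric"],
          where ?x1.0 = "fst p" and ?x2.0 = "fst q" and ?y1.0 = "snd p" and ?y2.0 = "snd q"]
      by (auto simp: dist_norm)
    show "mdist C_unit (?g p) (?g q) \<le> (1 + K) * ?d"
    proof (rule mdist_C_unit_le[THEN iffD2])
      show "\<forall>t\<in>{0..1}. \<bar>?g p t - ?g q t\<bar> \<le> (1 + K) * ?d"
      proof
        fix t :: real assume t: "t \<in> {0..1}"
        have "\<bar>fst p t - fst q t\<bar> \<le> ?d"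
          using mdist_C_unit_le[of "fst p" "fst q"] d(1) pq t by auto
        moreover have "\<bar>D t \<bullet> (snd p - snd q)\<bar> \<le> K * ?d"
          using Cauchy_Schwarz_ineq2[of "D t" "snd p - snd q"] K t d(2)
          by (smt (verit) mult_mono norm_ge_zero)
        moreover have "?g p t - ?g q t = (fst p t - fst q t) - D t \<bullet> (snd p - snd q)"
          using t by (simp add: inner_diff_right)
        ultimately show "\<bar>?g p t - ?g q t\<bar> \<le> (1 + K) * ?d"
          by (simp only: distrib_right mult_1)
      qed
    qed (use g pq in auto)
  qed
qed

text \<open>With the estimator frozen at one value, such a translation turns the process centred at
  the true function into the plug-in process.\<close>

lemma continuous_map_C_unit_diff:
  assumes c: "continuous_on {0..1} c"
  shows "continuous_map (mtopology_of C_unit) (mtopology_of C_unit) (\<lambda>f. \<lambda>t\<in>{0..1}. f t - c t)"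
    (is "continuous_map _ _ ?g")
proof (rule Lipschitz_continuous_imp_continuous_map)
  have g: "?g f \<in> mspace C_unit" if "f \<in> mspace C_unit" for f
    using that c by (intro restrict_mem_C_unit continuous_intros) (simp_all add: mspace_C_unit)
  show "Lipschitz_continuous_map C_unit C_unit ?g"
    unfolding Lipschitz_continuous_map_def
  proof (intro conjI exI[of _ 1] ballI)
    fix f h assume fh: "f \<in> mspace C_unit" "h \<in> mspace C_unit"
    show "mdist C_unit (?g f) (?g h) \<le> 1 * mdist C_unit f h"
      using mdist_C_unit_le[of f h "mdist C_unit f h"] fh
      by (subst mdist_C_unit_le) (auto intro: g)
  qed (use g in auto)
qed

text \<open>\<open>An\<close> is arbitrary, so one argument serves both estimators. The finite range
  of \<open>\<theta> n\<close> is there for the measurability of the plug-in process.\<close>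

lemma delta_method_C_unit:
  fixes A :: "'a::euclidean_space \<Rightarrow> real \<Rightarrow> real" and \<theta> :: "nat \<Rightarrow> 'w \<Rightarrow> 'a"
  assumes M: "prob_space M" and N: "prob_space N"
    and R: "regular_family \<O> A A'" and \<theta>\<^sub>0: "\<theta>\<^sub>0 \<in> \<O>"
    and A: "\<And>\<eta>. \<eta> \<in> \<O> \<Longrightarrow> continuous_on {0..1} (A \<eta>)"
    and \<theta>_mem: "\<And>n \<omega>. n \<ge> 1 \<Longrightarrow> \<omega> \<in> space M \<Longrightarrow> \<theta> n \<omega> \<in> \<O>"
    and \<theta>_range: "\<And>n. n \<ge> 1 \<Longrightarrow> finite (\<theta> n ` space M)"
    and W: "weakly_converges (prod_metric C_unit euclidean_metric) M
              (\<lambda>n \<omega>. (\<lambda>t\<in>{0..1}. sqrt (real n) * (An n \<omega> t - A \<theta>\<^sub>0 t),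
                      sqrt (real n) *\<^sub>R (\<theta> n \<omega> - \<theta>\<^sub>0)))
              N (\<lambda>\<omega>. (restrict (L \<omega>) {0..1}, \<Theta> \<omega>))"
  shows "weakly_converges C_unit M
           (\<lambda>n \<omega>. \<lambda>t\<in>{0..1}. sqrt (real n) * (An n \<omega> t - A (\<theta> n \<omega>) t))
           N (\<lambda>\<omega>. \<lambda>t\<in>{0..1}. L \<omega> t - A' \<theta>\<^sub>0 t \<bullet> \<Theta> \<omega>)"
proof -
  interpret M: prob_space M by (rule M)
  define G where "G = (\<lambda>n \<omega>. \<lambda>t\<in>{0..1}. sqrt (real n) * (An n \<omega> t - A \<theta>\<^sub>0 t))"
  define V where "V = (\<lambda>n \<omega>. sqrt (real n) *\<^sub>R (\<theta> n \<omega> - \<theta>\<^sub>0))"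
  define Z where "Z = (\<lambda>n \<omega>. \<lambda>t\<in>{0..1}. sqrt (real n) * (An n \<omega> t - A (\<theta> n \<omega>) t))"
  have W': "weakly_converges (prod_metric C_unit euclidean_metric) M
              (\<lambda>n \<omega>. (G n \<omega>, V n \<omega>)) N (\<lambda>\<omega>. (restrict (L \<omega>) {0..1}, \<Theta> \<omega>))"
    using W by (simp add: G_def V_def)
  have D: "continuous_on {0..1} (A' \<theta>\<^sub>0)"
    by (rule regular_family_gradient_continuous[OF R \<theta>\<^sub>0 A])
  have V_conv: "weakly_converges euclidean_metric M V N \<Theta>"
    using weakly_converges_continuous_map[OF W', of euclidean_metric snd]
    by (simp add: continuous_map_snd)
  have G_meas: "G n \<in> M \<rightarrow>\<^sub>M borel_metric C_unit" for n
    using weakly_converges_continuous_map[OF W', of C_unit fst]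
    by (simp add: continuous_map_fst weakly_converges_def)
  have V_meas: "V n \<in> borel_measurable M" for n
    using V_conv borel_measurable_continuous_map_compose[of _ _ euclidean_metric "\<lambda>x. x"]
    by (auto simp: weakly_converges_def)
  have Z_meas: "Z n \<in> M \<rightarrow>\<^sub>M borel_metric C_unit" for n
  proof (cases "n = 0")
    case True
    \<comment> \<open>For \<open>n = 0\<close> the factor \<open>sqrt 0\<close> makes every path the
      zero function.\<close>
    have "(\<lambda>\<omega>. \<lambda>t\<in>{0..1}. 0 :: real) \<in> M \<rightarrow>\<^sub>M borel_metric C_unit"
      by (rule measurable_const) (simp add: restrict_mem_C_unit)
    then show ?thesis using True by (simp add: Z_def)
  next
    case False
    then have n: "n \<ge> 1" by simp
    \<comment> \<open>For fixed \<eta> this is a translation of \<open>C_unit\<close>, hence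
      continuous; the random translation is glued from finitely many of them.\<close>
    define \<tau> where "\<tau> = (\<lambda>\<eta> f. \<lambda>t\<in>{0..1}. f t - sqrt (real n) * (A \<eta> t - A \<theta>\<^sub>0 t))"
    have "(\<lambda>\<omega>. \<tau> (\<theta> n \<omega>) (G n \<omega>)) \<in> M \<rightarrow>\<^sub>M borel_metric C_unit"
    proof (rule measurable_compose_countable'[where f = "\<lambda>\<eta> \<omega>. \<tau> \<eta> (G n \<omega>)"
          and g = "\<theta> n" and I = "\<theta> n ` space M"])
      show cI: "countable (\<theta> n ` space M)" using \<theta>_range[OF n] by (rule countable_finite)
      show "(\<lambda>\<omega>. \<tau> \<eta> (G n \<omega>)) \<in> M \<rightarrow>\<^sub>M borel_metric C_unit" if "\<eta> \<in> \<theta> n ` space M" for \<eta>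
      proof (rule measurable_compose[OF G_meas])
        have "\<eta> \<in> \<O>" using that \<theta>_mem[OF n] by auto
        then show "\<tau> \<eta> \<in> borel_metric C_unit \<rightarrow>\<^sub>M borel_metric C_unit"
          unfolding \<tau>_def using A \<theta>\<^sub>0
          by (intro measurable_borel_metric_continuous_map continuous_map_C_unit_diff
              continuous_intros) auto
      qed
      show "\<theta> n \<in> M \<rightarrow>\<^sub>M count_space (\<theta> n ` space M)"
        unfolding measurable_count_space_eq_countable[OF cI]
      proof (intro conjI ballI)
        fix a assume "a \<in> \<theta> n ` space M"
        \<comment> \<open>\<open>V n\<close> is an injective affine image of
          \<open>\<theta> n\<close> because \<open>n \<ge> 1\<close>, and its measurability is part
          of the joint convergence.\<close>
        have "\<theta> n -` {a} \<inter> space M = V n -` {sqrt (real n) *\<^sub>R (a - \<theta>\<^sub>0)} \<inter> space M"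
          using n by (auto simp: V_def)
        then show "\<theta> n -` {a} \<inter> space M \<in> sets M"
          using measurable_sets[OF V_meas] by simp
      qed auto
    qed
    moreover have "\<tau> (\<theta> n \<omega>) (G n \<omega>) = Z n \<omega>" for \<omega>
      by (auto simp: \<tau>_def G_def Z_def fun_eq_iff algebra_simps)
    ultimately show ?thesis by simp
  qed
  define g where "g = (\<lambda>p :: (real \<Rightarrow> real) \<times> 'a. \<lambda>t\<in>{0..1}. fst p t - A' \<theta>\<^sub>0 t \<bullet> snd p)"
  have g: "weakly_converges C_unit M (\<lambda>n \<omega>. g (G n \<omega>, V n \<omega>)) N
      (\<lambda>\<omega>. g (restrict (L \<omega>) {0..1}, \<Theta> \<omega>))"
    unfolding g_def
    by (rule weakly_converges_continuous_map[OF W' continuous_map_C_unit_sub_inner[OF D]])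
  have "weakly_converges C_unit M Z N (\<lambda>\<omega>. g (restrict (L \<omega>) {0..1}, \<Theta> \<omega>))"
  proof (rule weakly_converges_converging_together[OF M N g Z_meas])
    fix e :: real assume e: "e > 0"
    obtain K where K: "K > 0"
      "\<forall>\<^sub>F n in sequentially. measure M {\<omega> \<in> space M. norm (V n \<omega>) > K} \<le> e"
      using weakly_converges_tight[OF M N V_conv e] by blast
    \<comment> \<open>With tolerance \<open>e / K\<close> the scaled remainder is at most
      \<open>e / K * norm (V n \<omega>)\<close>, hence at most \<open>e\<close> wherever
      \<open>V n\<close> is bounded by \<open>K\<close>.\<close>
    obtain \<delta> where \<delta>: "\<delta> > 0"
      "\<And>\<eta> t. norm (\<eta> - \<theta>\<^sub>0) < \<delta> \<Longrightarrow> t \<in> {0..1} \<Longrightarrow>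
         \<bar>A \<eta> t - A \<theta>\<^sub>0 t - A' \<theta>\<^sub>0 t \<bullet> (\<eta> - \<theta>\<^sub>0)\<bar> \<le> e / K * norm (\<eta> - \<theta>\<^sub>0)"
      using regular_family_expansion[OF R \<theta>\<^sub>0, of "e / K"] e K(1)
      by (metis divide_pos_pos)
    have "(\<lambda>n. K / sqrt (real n)) \<longlonglongrightarrow> 0"
      by (intro tendsto_divide_0[OF tendsto_const] filterlim_at_top_imp_at_infinity
          filterlim_compose[OF sqrt_at_top] filterlim_real_sequentially)
    then have "\<forall>\<^sub>F n in sequentially. K / sqrt (real n) < \<delta>"
      using \<delta>(1) by (rule order_tendstoD(2))
    with K(2) eventually_ge_at_top[of "1 :: nat"]
    show "\<forall>\<^sub>F n in sequentially. \<exists>E\<in>sets M. measure M E \<le> e \<and>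
        (\<forall>\<omega>\<in>space M - E. mdist C_unit (g (G n \<omega>, V n \<omega>)) (Z n \<omega>) \<le> e)"
    proof eventually_elim
      case (elim n)
      let ?E = "{\<omega> \<in> space M. norm (V n \<omega>) > K}"
      have E: "?E \<in> sets M" using V_meas[of n] by measurable
      have "mdist C_unit (g (G n \<omega>, V n \<omega>)) (Z n \<omega>) \<le> e" if w: "\<omega> \<in> space M - ?E" for \<omega>
      proof (subst mdist_C_unit_le)
        show "g (G n \<omega>, V n \<omega>) \<in> mspace C_unit"
          using g w measurable_space[of "\<lambda>\<omega>. g (G n \<omega>, V n \<omega>)" M "borel_metric C_unit" \<omega>]
          by (simp add: weakly_converges_def)
        show "Z n \<omega> \<in> mspace C_unit"
          using w measurable_space[OF Z_meas, of \<omega>] by simp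
        show "\<forall>t\<in>{0..1}. \<bar>g (G n \<omega>, V n \<omega>) t - Z n \<omega> t\<bar> \<le> e"
        proof
          fix t :: real assume t: "t \<in> {0..1}"
          have n: "sqrt (real n) > 0" using elim by simp
          have VK: "norm (V n \<omega>) \<le> K" using w by auto
          have V_norm: "norm (V n \<omega>) = sqrt (real n) * norm (\<theta> n \<omega> - \<theta>\<^sub>0)"
            by (simp add: V_def)
          then have "norm (\<theta> n \<omega> - \<theta>\<^sub>0) \<le> K / sqrt (real n)"
            using VK n by (simp add: field_simps)
          then have small: "norm (\<theta> n \<omega> - \<theta>\<^sub>0) < \<delta>" using elim by linarith
          \<comment> \<open>The terms with \<open>An\<close> cancel, which leaves the scaled
            remainder of the first-order expansion.\<close>
          have "g (G n \<omega>, V n \<omega>) t - Z n \<omega> t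
            = sqrt (real n) * (A (\<theta> n \<omega>) t - A \<theta>\<^sub>0 t - A' \<theta>\<^sub>0 t \<bullet> (\<theta> n \<omega> - \<theta>\<^sub>0))"
            using t by (simp add: g_def G_def V_def Z_def algebra_simps)
          also have "\<bar>\<dots>\<bar> = sqrt (real n) * \<bar>A (\<theta> n \<omega>) t - A \<theta>\<^sub>0 t - A' \<theta>\<^sub>0 t \<bullet> (\<theta> n \<omega> - \<theta>\<^sub>0)\<bar>"
            using n by (simp add: abs_mult)
          also have "\<dots> \<le> sqrt (real n) * (e / K * norm (\<theta> n \<omega> - \<theta>\<^sub>0))"
            using n by (intro mult_left_mono \<delta>(2)[OF small t]) auto
          also have "\<dots> = e / K * norm (V n \<omega>)" by (simp add: V_norm)
          also have "\<dots> \<le> e / K * K" using VK e K(1) by (intro mult_left_mono) auto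
          finally show "\<bar>g (G n \<omega>, V n \<omega>) t - Z n \<omega> t\<bar> \<le> e" using K(1) by simp
        qed
      qed
      then show ?case using E elim by blast
    qed
  qed
  moreover have "g (restrict (L \<omega>) {0..1}, \<Theta> \<omega>) = (\<lambda>t\<in>{0..1}. L \<omega> t - A' \<theta>\<^sub>0 t \<bullet> \<Theta> \<omega>)" for \<omega>
    by (auto simp: g_def fun_eq_iff)
  ultimately show ?thesis by (simp add: Z_def)
qed

section \<open>Copulas\<close>

text \<open>Monotonicity and continuity make the sublevel set a closed half-line
  \<open>{..s}\<close>, of mass \<open>cdf \<mu> s\<close>; a point at level \<open>u\<close>, given
  by the intermediate value theorem, shows that this mass is \<open>u\<close>. The cdf may have flat
  parts, so no inverse is used.\<close>

lemma cdf_probability_integral_transform: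
  assumes "real_distribution \<mu>" and F: "continuous_on UNIV (cdf \<mu>)" and u: "u \<in> {0..1}"
  shows "measure \<mu> {x. cdf \<mu> x \<le> u} = u"
proof -
  interpret real_distribution \<mu> by fact
  have closed: "closed {x. cdf \<mu> x \<le> u}" for u
    by (intro closed_Collect_le F continuous_on_const)
  then have meas: "{x. cdf \<mu> x \<le> u} \<in> sets \<mu>" for u by simp
  \<comment> \<open>Levels 0 and 1 are treated apart: at 0 the sublevel set may be empty, at 1 it is
    the whole line, so a largest point may not exist.\<close>
  have interior: "measure \<mu> {x. cdf \<mu> x \<le> u} = u" if u: "0 < u" "u < 1" for u
  proof -
    define S where "S = {x. cdf \<mu> x \<le> u}"
    obtain a where a: "cdf \<mu> a < u"
      using order_tendstoD(2)[OF cdf_lim_at_bot u(1)] eventually_happens'[OF trivial_limit_at_bot_linorder] by blast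
    obtain b where b: "u < cdf \<mu> b"
      using order_tendstoD(1)[OF cdf_lim_at_top_prob u(2)] eventually_happens'[OF trivial_limit_at_top_linorder]
      by blast
    have ab: "a \<le> b" using cdf_nondecreasing[of b a] a b by linarith
    obtain c where c: "cdf \<mu> c = u"
      using IVT'[of "cdf \<mu>" a u b] a b ab continuous_on_subset[OF F subset_UNIV] by force
    have S: "S \<noteq> {}" "bdd_above S" "closed S"
    proof -
      show "S \<noteq> {}" using a by (auto simp: S_def intro: less_imp_le)
      show "bdd_above S"
      proof (rule bdd_aboveI)
        fix x assume "x \<in> S"
        then have "cdf \<mu> x < cdf \<mu> b" using b by (simp add: S_def)
        then show "x \<le> b" using cdf_nondecreasing[of b x] by linarith
      qed
      show "closed S" unfolding S_def by (rule closed)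
    qed
    define s where "s = Sup S"
    have s: "s \<in> S" unfolding s_def by (rule closed_contains_Sup[OF S])
    have S_eq: "S = {..s}"
    proof (intro set_eqI iffI)
      show "x \<in> {..s}" if "x \<in> S" for x using that S(2) by (simp add: s_def cSup_upper)
      show "x \<in> S" if "x \<in> {..s}" for x
        using that s cdf_nondecreasing[of x s] by (simp add: S_def)
    qed
    have "c \<in> S" using c by (simp add: S_def)
    then have "u \<le> cdf \<mu> s" using c cdf_nondecreasing[of c s] S_eq by simp
    then have "cdf \<mu> s = u" using s by (simp add: S_def)
    then show ?thesis using S_eq by (simp add: S_def cdf_def)
  qed
  consider "u = 0" | "0 < u" "u < 1" | "u = 1" using u by fastforce
  then show ?thesis
  proof cases
    case 1
    \<comment> \<open>The set lies in the sublevel set of every positive level; the cap 1 / 2 keeps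
      that level below 1.\<close>
    have "measure \<mu> {x. cdf \<mu> x \<le> 0} \<le> 0 + e" if e: "e > 0" for e
    proof -
      have "measure \<mu> {x. cdf \<mu> x \<le> 0} \<le> measure \<mu> {x. cdf \<mu> x \<le> min e (1 / 2)}"
        using e by (intro finite_measure_mono meas) (auto intro: order_trans)
      also have "\<dots> = min e (1 / 2)" using e by (intro interior) auto
      finally show ?thesis by simp
    qed
    then have "measure \<mu> {x. cdf \<mu> x \<le> 0} \<le> 0" by (rule field_le_epsilon)
    then show ?thesis using 1 by (simp add: measure_le_0_iff)
  next
    case 2
    then show ?thesis by (rule interior)
  next
    case 3
    then show ?thesis using prob_space by (simp add: cdf_bounded_prob)
  qed
qed

text \<open>Raising the level from \<open>u\<close> to \<open>u'\<close> adds at most the slab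
  between them, whose mass is \<open>u' - u\<close> by uniformity. With \<open>f\<close> one
  transformed coordinate and \<open>B\<close> an event for the other, this is the Lipschitz bound
  for a copula in one argument.\<close>

lemma (in prob_space) measure_Int_le_add_uniform:
  fixes f :: "'a \<Rightarrow> real"
  assumes f: "f \<in> borel_measurable M" and B: "B \<in> sets M"
    and unif: "\<And>u. u \<in> {0..1} \<Longrightarrow> measure M {x \<in> space M. f x \<le> u} = u"
    and u: "0 \<le> u" "u \<le> u'" "u' \<le> 1"
  shows "measure M ({x \<in> space M. f x \<le> u'} \<inter> B) \<le> measure M ({x \<in> space M. f x \<le> u} \<inter> B) + (u' - u)"
    and "measure M ({x \<in> space M. f x \<le> u} \<inter> B) \<le> measure M ({x \<in> space M. f x \<le> u'} \<inter> B)"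
proof -
  let ?E = "\<lambda>u. {x \<in> space M. f x \<le> u}"
  have E: "?E u \<in> sets M" for u using f by measurable
  have sub: "?E u \<subseteq> ?E u'" using u by auto
  have "measure M (?E u' \<inter> B) \<le> measure M ((?E u \<inter> B) \<union> (?E u' - ?E u))"
    using E B by (intro finite_measure_mono) auto
  also have "\<dots> \<le> measure M (?E u \<inter> B) + measure M (?E u' - ?E u)"
    using E B by (intro measure_Un_le) auto
  also have "measure M (?E u' - ?E u) = u' - u"
    using finite_measure_Diff[OF E E sub] unif[of u] unif[of u'] u by simp
  finally show "measure M (?E u' \<inter> B) \<le> measure M (?E u \<inter> B) + (u' - u)" .
  show "measure M (?E u \<inter> B) \<le> measure M (?E u' \<inter> B)"
    using E B sub by (intro finite_measure_mono) auto
qed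

text \<open>By the probability integral transform the events F(X) \<le> u and G(Y) \<le> v have
  probabilities u and v, and \<open>C u v\<close> is the probability of their intersection.\<close>

lemma copula_properties:
  assumes "copula C"
  shows copula_le_fst: "\<And>u v. u \<in> {0..1} \<Longrightarrow> v \<in> {0..1} \<Longrightarrow> C u v \<le> u"
    and copula_le_snd: "\<And>u v. u \<in> {0..1} \<Longrightarrow> v \<in> {0..1} \<Longrightarrow> C u v \<le> v"
    and copula_1_1: "C 1 1 = 1"
    and copula_lipschitz: "\<And>u v u' v'. u \<in> {0..1} \<Longrightarrow> v \<in> {0..1} \<Longrightarrow> u' \<in> {0..1} \<Longrightarrow> v' \<in> {0..1} \<Longrightarrow>
          \<bar>C u v - C u' v'\<bar> \<le> \<bar>u - u'\<bar> + \<bar>v - v'\<bar>"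
proof -
  obtain H where H: "has_copula H C" using assms by (auto simp: copula_def)
  define F where "F = cdf (distr H borel fst)"
  define G where "G = cdf (distr H borel snd)"
  interpret H: prob_space H using H by (simp add: has_copula_def)
  have sets: "sets H = sets borel" and F: "continuous_on UNIV F" and G: "continuous_on UNIV G"
    and C: "\<And>u v. u \<in> {0..1} \<Longrightarrow> v \<in> {0..1} \<Longrightarrow>
          C u v = measure H {z. F (fst z) \<le> u \<and> G (snd z) \<le> v}"
    using H by (simp_all add: has_copula_def F_def G_def Let_def)
  have space: "space H = UNIV" using sets_eq_imp_space_eq[OF sets] by simp
  have fst: "fst \<in> H \<rightarrow>\<^sub>M borel" and snd: "snd \<in> H \<rightarrow>\<^sub>M borel"
    unfolding measurable_cong_sets[OF sets refl]
    by (intro borel_measurable_continuous_onI continuous_intros)+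
  have unif: "measure H {z. cdf (distr H borel p) (p z) \<le> u} = u"
    if p: "p \<in> H \<rightarrow>\<^sub>M borel" and c: "continuous_on UNIV (cdf (distr H borel p))"
      and u: "u \<in> {0..1}" for p u
  proof -
    have "real_distribution (distr H borel p)"
      using H.prob_space_distr[OF p] by (simp add: real_distribution_def real_distribution_axioms_def)
    then have "measure (distr H borel p) {x. cdf (distr H borel p) x \<le> u} = u"
      using c u by (rule cdf_probability_integral_transform)
    moreover have "{x. cdf (distr H borel p) x \<le> u} \<in> sets borel"
      by (intro borel_closed closed_Collect_le c continuous_on_const)
    ultimately show ?thesis
      using p by (simp add: measure_distr space vimage_def)
  qed
  have uF: "measure H {z \<in> space H. F (fst z) \<le> u} = u"
    and uG: "measure H {z \<in> space H. G (snd z) \<le> u} = u" if "u \<in> {0..1}" for u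
    using unif[OF fst F[unfolded F_def] that] unif[OF snd G[unfolded G_def] that]
    by (simp_all add: F_def G_def space)
  have Fm: "(\<lambda>z. F (fst z)) \<in> borel_measurable H" and Gm: "(\<lambda>z. G (snd z)) \<in> borel_measurable H"
    using measurable_compose[OF fst borel_measurable_continuous_onI[OF F]]
      measurable_compose[OF snd borel_measurable_continuous_onI[OF G]] by auto
  let ?A = "\<lambda>u. {z \<in> space H. F (fst z) \<le> u}" and ?B = "\<lambda>v. {z \<in> space H. G (snd z) \<le> v}"
  have A: "?A u \<in> sets H" and B: "?B u \<in> sets H" for u using Fm Gm by measurable
  \<comment> \<open>Both orders of the intersection are kept so that the one-argument estimate
    applies to either coordinate.\<close>
  have C': "C u v = measure H (?A u \<inter> ?B v)" "C u v = measure H (?B v \<inter> ?A u)"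
    if "u \<in> {0..1}" "v \<in> {0..1}" for u v
    using C[OF that] by (simp_all add: space Collect_conj_eq Int_commute)
  show "C u v \<le> u" if uv: "u \<in> {0..1}" "v \<in> {0..1}" for u v
  proof -
    have "C u v \<le> measure H (?A u)"
      unfolding C'(1)[OF uv] using A by (intro H.finite_measure_mono) auto
    then show ?thesis using uF[OF uv(1)] by simp
  qed
  show "C u v \<le> v" if uv: "u \<in> {0..1}" "v \<in> {0..1}" for u v
  proof -
    have "C u v \<le> measure H (?B v)"
      unfolding C'(1)[OF uv] using B by (intro H.finite_measure_mono) auto
    then show ?thesis using uG[OF uv(2)] by simp
  qed
  have "F x \<le> 1" "G x \<le> 1" for x
    using prob_space.prob_le_1[OF H.prob_space_distr[OF fst]] prob_space.prob_le_1[OF H.prob_space_distr[OF snd]]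
    by (auto simp: F_def G_def cdf_def)
  then show "C 1 1 = 1" using C[of 1 1] H.prob_space space by simp
  have d1: "\<bar>C u v - C u' v\<bar> \<le> \<bar>u - u'\<bar>" if h: "u \<in> {0..1}" "u' \<in> {0..1}" "v \<in> {0..1}" for u u' v
    using H.measure_Int_le_add_uniform[OF Fm B uF, of u u' v]
      H.measure_Int_le_add_uniform[OF Fm B uF, of u' u v] C'(1)[of u v] C'(1)[of u' v] h
    by (cases "u \<le> u'") auto
  have d2: "\<bar>C u v - C u v'\<bar> \<le> \<bar>v - v'\<bar>" if h: "u \<in> {0..1}" "v \<in> {0..1}" "v' \<in> {0..1}" for u v v'
    using H.measure_Int_le_add_uniform[OF Gm A uG, of v v' u]
      H.measure_Int_le_add_uniform[OF Gm A uG, of v' v u] C'(2)[of u v] C'(2)[of u v'] h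
    by (cases "v \<le> v'") auto
  show "\<bar>C u v - C u' v'\<bar> \<le> \<bar>u - u'\<bar> + \<bar>v - v'\<bar>"
    if "u \<in> {0..1}" "v \<in> {0..1}" "u' \<in> {0..1}" "v' \<in> {0..1}" for u v u' v'
    using d1[of u u' v] d2[of u' v v'] that by linarith
qed

lemma copula_continuous_on_comp:
  assumes C: "copula C" and f: "continuous_on S f" "f ` S \<subseteq> {0..1}"
    and g: "continuous_on S g" "g ` S \<subseteq> {0..1}"
  shows "continuous_on S (\<lambda>x. C (f x) (g x))"
  unfolding continuous_on_def
proof
  fix x assume x: "x \<in> S"
  have "((\<lambda>y. \<bar>f y - f x\<bar> + \<bar>g y - g x\<bar>) \<longlongrightarrow> \<bar>f x - f x\<bar> + \<bar>g x - g x\<bar>) (at x within S)"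
    using f(1) g(1) x by (intro tendsto_intros) (auto simp: continuous_on_def)
  then have "((\<lambda>y. \<bar>f y - f x\<bar> + \<bar>g y - g x\<bar>) \<longlongrightarrow> 0) (at x within S)" by simp
  moreover have "\<forall>\<^sub>F y in at x within S. norm (C (f y) (g y) - C (f x) (g x)) \<le> \<bar>f y - f x\<bar> + \<bar>g y - g x\<bar>"
    unfolding eventually_at_filter
    using copula_lipschitz[OF C] x f(2) g(2) by (intro always_eventually) (auto simp: image_subset_iff)
  ultimately have "((\<lambda>y. C (f y) (g y) - C (f x) (g x)) \<longlongrightarrow> 0) (at x within S)"
    by (rule Lim_null_comparison[rotated])
  then show "((\<lambda>x. C (f x) (g x)) \<longlongrightarrow> C (f x) (g x)) (at x within S)"
    by (rule LIM_zero_cancel)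
qed

section \<open>Bounds for left-tail decreasing copulas\<close>

text \<open>The LTD ratio is compared with its value at the corner (1,1), where it is 1. The
  conclusion is positive quadrant dependence.\<close>

lemma LTD_ge_mult:
  assumes "copula C" "LTD C" "0 < u" "u \<le> 1" "0 < v" "v \<le> 1"
  shows "u * v \<le> C u v"
proof -
  have "C u v / (u * v) \<ge> C 1 1 / (1 * 1)"
    using assms by (simp only: LTD_def) blast
  then show ?thesis using assms copula_1_1[OF assms(1)] by (simp add: field_simps)
qed

text \<open>The two arguments multiply to \<open>x\<close>, whence the lower bound; one of the
  exponents \<open>t\<close> and \<open>1 - t\<close> is at least 1 / 2, whence the upper one.
  Neither bound depends on \<open>t\<close>, as dominated convergence requires.\<close>

lemma LTD_diagonal_bounds:
  assumes C: "copula C" "LTD C" and x: "0 < x" "x < 1" and t: "t \<in> {0..1}"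
  shows "x \<le> C (x powr (1 - t)) (x powr t)" "C (x powr (1 - t)) (x powr t) \<le> x powr (1 / 2)"
    "C (x powr (1 - t)) (x powr t) \<le> 1"
proof -
  have p: "0 < x powr s" "x powr s \<le> 1" if "0 \<le> s" for s
    using x that powr_le1[of s x] by auto
  have "x powr (1 - t) * x powr t = x" using x by (simp add: powr_add[symmetric])
  then show "x \<le> C (x powr (1 - t)) (x powr t)"
    using LTD_ge_mult[OF C, of "x powr (1 - t)" "x powr t"] p t by auto
  have le: "C (x powr (1 - t)) (x powr t) \<le> x powr (1 - t)" "C (x powr (1 - t)) (x powr t) \<le> x powr t"
    using copula_le_fst[OF C(1)] copula_le_snd[OF C(1)] p t by auto
  then show "C (x powr (1 - t)) (x powr t) \<le> 1" using p(2)[of t] t by simp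
  show "C (x powr (1 - t)) (x powr t) \<le> x powr (1 / 2)"
  proof (cases "t \<le> 1 / 2")
    case True
    then have "x powr (1 - t) \<le> x powr (1 / 2)" using x by (intro powr_mono') auto
    then show ?thesis using le by linarith
  next
    case False
    then have "x powr t \<le> x powr (1 / 2)" using x by (intro powr_mono') auto
    then show ?thesis using le by linarith
  qed
qed

section \<open>Continuity of the two functionals in t\<close>

lemma continuous_on_set_lebesgue_integral:
  fixes f :: "real \<Rightarrow> real \<Rightarrow> real"
  assumes cont: "\<And>x. x \<in> S \<Longrightarrow> continuous_on T (\<lambda>t. f t x)"
    and meas: "\<And>t. t \<in> T \<Longrightarrow> set_borel_measurable lborel S (f t)"
    and bound: "\<And>t x. t \<in> T \<Longrightarrow> x \<in> S \<Longrightarrow> \<bar>f t x\<bar> \<le> w x" and w: "set_integrable lborel S w"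
  shows "continuous_on T (\<lambda>t. LBINT x:S. f t x)"
    and "\<And>t. t \<in> T \<Longrightarrow> set_integrable lborel S (f t)"
proof -
  show "continuous_on T (\<lambda>t. LBINT x:S. f t x)"
    unfolding continuous_on_sequentially
  proof (intro allI ballI impI)
    fix \<tau> :: "nat \<Rightarrow> real" and t assume t: "t \<in> T" and \<tau>: "(\<forall>n. \<tau> n \<in> T) \<and> \<tau> \<longlonglongrightarrow> t"
    show "((\<lambda>t. LBINT x:S. f t x) \<circ> \<tau>) \<longlonglongrightarrow> (LBINT x:S. f t x)"
      unfolding set_lebesgue_integral_def o_def
    proof (rule integral_dominated_convergence[where w = "\<lambda>x. indicator S x *\<^sub>R w x"])
      show "AE x in lborel. (\<lambda>n. indicator S x *\<^sub>R f (\<tau> n) x) \<longlonglongrightarrow> indicator S x *\<^sub>R f t x"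
      proof (rule AE_I2)
        fix x
        show "(\<lambda>n. indicator S x *\<^sub>R f (\<tau> n) x) \<longlonglongrightarrow> indicator S x *\<^sub>R f t x"
        proof (cases "x \<in> S")
          case True
          then have "(\<lambda>n. f (\<tau> n) x) \<longlonglongrightarrow> f t x"
            using continuous_on_tendsto_compose[OF cont[OF True], of \<tau> t sequentially] t \<tau> by simp
          then show ?thesis using True by simp
        qed simp
      qed
      show "(\<lambda>x. indicator S x *\<^sub>R f t x) \<in> borel_measurable lborel"
        "\<And>n. (\<lambda>x. indicator S x *\<^sub>R f (\<tau> n) x) \<in> borel_measurable lborel"
        using meas t \<tau> unfolding set_borel_measurable_def by blast+
      show "integrable lborel (\<lambda>x. indicator S x *\<^sub>R w x)"
        using w by (simp add: set_integrable_def)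
      show "AE x in lborel. norm (indicator S x *\<^sub>R f (\<tau> n) x) \<le> indicator S x *\<^sub>R w x" for n
        using bound \<tau> by (intro AE_I2) (simp split: split_indicator)
    qed
  qed
  show "set_integrable lborel S (f t)" if t: "t \<in> T" for t
    unfolding set_integrable_def
  proof (rule Bochner_Integration.integrable_bound)
    show "integrable lborel (\<lambda>x. indicator S x *\<^sub>R w x)" using w by (simp add: set_integrable_def)
    show "AE x in lborel. norm (indicator S x *\<^sub>R f t x) \<le> norm (indicator S x *\<^sub>R w x)"
      using bound[OF t] by (intro AE_I2) (auto simp: indicator_def intro: order_trans[OF _ abs_ge_self])
  qed (use meas[OF t] in \<open>simp add: set_borel_measurable_def\<close>)
qed

text \<open>This majorant is the bound \<open>x powr (1 / 2)\<close> on the copula divided by the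
  \<open>x\<close> of dx/x. Its antiderivative is \<open>2 * x powr (1 / 2)\<close>.\<close>

lemma set_integrable_inverse_sqrt: "set_integrable lborel {0<..<1} (\<lambda>x::real. x powr (- 1 / 2))"
proof -
  have "set_integrable lborel (einterval 0 1) (\<lambda>x::real. x powr (- 1 / 2))"
  proof (rule interval_integral_FTC_nonneg(1)[where F = "\<lambda>x. 2 * x powr (1 / 2)" and A = 0 and B = 2])
    have "((\<lambda>x::real. 2 * x powr (1 / 2)) \<longlongrightarrow> 2 * 0 powr (1 / 2)) (at_right 0)"
      by (intro tendsto_intros tendsto_powr') (auto simp: eventually_at_filter)
    then show "(((\<lambda>x::real. 2 * x powr (1 / 2)) \<circ> real_of_ereal) \<longlongrightarrow> 0) (at_right 0)"
      by (simp add: zero_ereal_def ereal_tendsto_simps)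
    have "((\<lambda>x::real. 2 * x powr (1 / 2)) \<longlongrightarrow> 2 * 1 powr (1 / 2)) (at_left 1)"
      by (intro tendsto_intros) auto
    then show "(((\<lambda>x::real. 2 * x powr (1 / 2)) \<circ> real_of_ereal) \<longlongrightarrow> 2) (at_left 1)"
      by (simp add: one_ereal_def ereal_tendsto_simps)
    show "((\<lambda>x. 2 * x powr (1 / 2)) has_real_derivative x powr (- 1 / 2)) (at x)"
      if "0 < ereal x" for x
      using that by (auto intro!: derivative_eq_intros simp: zero_ereal_def)
    show "isCont (\<lambda>x. x powr (- 1 / 2)) x" if "0 < ereal x" for x
      using that by (auto intro!: continuous_intros simp: zero_ereal_def)
  qed auto
  moreover have "einterval 0 1 = {0<..<1}"
    by (auto simp: einterval_def zero_ereal_def one_ereal_def)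
  ultimately show ?thesis by simp
qed

lemma copula_diagonal_continuous:
  assumes "copula C" "0 < x" "x < 1"
  shows "continuous_on {0..1} (\<lambda>t. C (x powr (1 - t)) (x powr t))"
  by (rule copula_continuous_on_comp[OF assms(1)])
    (use assms(2,3) in \<open>auto intro!: continuous_intros powr_le1\<close>)

text \<open>The indicator matters: \<open>copula\<close> leaves the values of \<open>C\<close>
  outside the unit square arbitrary, so only the cut-off function is known to be measurable.\<close>

lemma copula_diagonal_measurable:
  assumes "copula C" "t \<in> {0..1}"
  shows "(\<lambda>x. indicator {0<..<1} x * C (x powr (1 - t)) (x powr t)) \<in> borel_measurable borel"
proof -
  have "continuous_on {0<..<1} (\<lambda>x. C (x powr (1 - t)) (x powr t))"
    by (rule copula_continuous_on_comp[OF assms(1)])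
      (use assms(2) in \<open>auto intro!: continuous_intros powr_le1\<close>)
  then show ?thesis
    using borel_measurable_continuous_on_indicator[of "{0<..<1}" "\<lambda>x. C (x powr (1 - t)) (x powr t)"]
    by simp
qed

lemma continuous_on_A_P:
  assumes C: "copula C" "LTD C"
  shows "continuous_on {0..1} (A_P C)"
proof -
  let ?f = "\<lambda>t x. C (x powr (1 - t)) (x powr t) / x"
  have meas: "set_borel_measurable lborel {0<..<1} (?f t)" if "t \<in> {0..1}" for t
    using borel_measurable_divide[OF copula_diagonal_measurable[OF C(1) that], of "\<lambda>x. x"]
    by (simp add: set_borel_measurable_def)
  have bound: "\<bar>?f t x\<bar> \<le> x powr (- 1 / 2)" if t: "t \<in> {0..1}" and x: "x \<in> {0<..<1}" for t x
  proof -
    have "\<bar>?f t x\<bar> = ?f t x"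
      using LTD_diagonal_bounds(1)[OF C, of x t] x t by simp
    also have "\<dots> \<le> x powr (1 / 2) / x"
      using LTD_diagonal_bounds(2)[OF C, of x t] x t by (intro divide_right_mono) auto
    also have "\<dots> = x powr (- 1 / 2)"
      using x powr_diff[of x "1 / 2" 1] by simp
    finally show ?thesis .
  qed
  have cont: "continuous_on {0..1} (\<lambda>t. ?f t x)" if "x \<in> {0<..<1}" for x
    using that by (intro continuous_intros copula_diagonal_continuous C) auto
  have I: "continuous_on {0..1} (\<lambda>t. LBINT x:{0<..<1}. ?f t x)"
    "\<And>t. t \<in> {0..1} \<Longrightarrow> set_integrable lborel {0<..<1} (?f t)"
    using continuous_on_set_lebesgue_integral[OF cont meas bound set_integrable_inverse_sqrt]
    by auto
  \<comment> \<open>The lower bound \<open>x\<close> on the copula makes the integrand at least 1 on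
    (0,1), so the reciprocal in \<open>A_P\<close> is continuous.\<close>
  have "(LBINT x:{0<..<1}. ?f t x) \<noteq> 0" if t: "t \<in> {0..1}" for t
  proof -
    have "(LBINT x:{0<..<1::real}. 1 :: real) \<le> (LBINT x:{0<..<1}. ?f t x)"
      using LTD_diagonal_bounds(1)[OF C _ _ t] I(2)[OF t]
      by (intro set_integral_mono) (auto simp: set_integrable_def)
    then show ?thesis by (simp add: set_lebesgue_integral_def)
  qed
  then show ?thesis
    unfolding A_P_def[abs_def] by (intro continuous_intros I(1)) auto
qed

text \<open>The weight is singular at both ends. Above \<open>exp (- 1)\<close> the subtracted 1
  leaves a numerator that vanishes at 1 fast enough; below, \<open>- ln x \<ge> 1\<close> and the
  square root bound suffices. \<open>?w\<close> is the sum of the two majorants,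
  \<open>exp 1\<close> being the bound of \<open>1 / x\<close> on the upper range.\<close>

lemma continuous_on_A_CFG:
  assumes C: "copula C" "LTD C"
  shows "continuous_on {0..1} (A_CFG C)"
proof -
  let ?f = "\<lambda>t x. (C (x powr (1 - t)) (x powr t) - of_bool (x > exp (- 1))) / (x * ln x)"
  let ?w = "\<lambda>x::real. x powr (- 1 / 2) + exp 1"
  have meas: "set_borel_measurable lborel {0<..<1} (?f t)" if t: "t \<in> {0..1}" for t
  proof -
    have [measurable]: "(\<lambda>x. indicator {0<..<1} x * C (x powr (1 - t)) (x powr t)) \<in> borel_measurable borel"
      by (rule copula_diagonal_measurable[OF C(1) t])
    have "(\<lambda>x::real. (indicator {0<..<1} x * C (x powr (1 - t)) (x powr t)
        - indicator {0<..<1} x * indicator {exp (- 1)<..} x) / (x * ln x)) \<in> borel_measurable borel"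
      by measurable
    also have "(\<lambda>x::real. (indicator {0<..<1} x * C (x powr (1 - t)) (x powr t)
        - indicator {0<..<1} x * indicator {exp (- 1)<..} x) / (x * ln x))
      = (\<lambda>x. indicator {0<..<1} x *\<^sub>R ?f t x)"
      by (auto simp: fun_eq_iff indicator_def)
    finally show ?thesis by (simp add: set_borel_measurable_def)
  qed
  have bound: "\<bar>?f t x\<bar> \<le> ?w x" if t: "t \<in> {0..1}" and x: "x \<in> {0<..<1}" for t x
  proof -
    note b = LTD_diagonal_bounds[OF C, of x t]
    have abs_den: "\<bar>x * ln x\<bar> = x * - ln x" using x by (simp add: abs_mult)
    show ?thesis
    proof (cases "x > exp (- 1)")
      case True
      have "\<bar>?f t x\<bar> = (1 - C (x powr (1 - t)) (x powr t)) / (x * - ln x)"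
        using True b x t by (simp add: abs_den abs_divide)
      \<comment> \<open>\<open>1 - x\<close> bounds the numerator from above by the LTD lower bound
        and bounds \<open>- ln x\<close> from below, so the zero of the logarithm at 1
        cancels.\<close>
      also have "\<dots> \<le> (1 - x) / (x * (1 - x))"
        using b x t ln_le_minus_one[of x]
        by (intro frac_le mult_left_mono) auto
      also have "\<dots> = 1 / x" using x by simp
      also have "\<dots> \<le> exp 1"
        using True x by (simp add: exp_minus field_simps)
      finally show ?thesis using powr_ge_zero[of x "- 1 / 2"] by linarith
    next
      case False
      then have ln: "1 \<le> - ln x" using x ln_le_cancel_iff[of x "exp (- 1)"] by simp
      have "\<bar>?f t x\<bar> = C (x powr (1 - t)) (x powr t) / (x * - ln x)"
        using False b x t by (simp add: abs_den abs_divide)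
      also have "\<dots> \<le> x powr (1 / 2) / (x * 1)"
        using b x t ln by (intro frac_le mult_left_mono) auto
      also have "\<dots> = x powr (- 1 / 2)"
        using x powr_diff[of x "1 / 2" 1] by simp
      finally show ?thesis by (simp add: add_increasing2)
    qed
  qed
  have w: "set_integrable lborel {0<..<1} ?w"
    by (intro set_integral_add set_integrable_inverse_sqrt) (simp add: set_integrable_def)
  have cont: "continuous_on {0..1} (\<lambda>t. ?f t x)" if "x \<in> {0<..<1}" for x
    using that by (intro continuous_intros copula_diagonal_continuous C) auto
  show ?thesis
    unfolding A_CFG_def[abs_def]
    by (intro continuous_intros continuous_on_set_lebesgue_integral(1)[OF cont meas bound w])
qed

section \<open>Rank vectors and the two estimators\<close>

text \<open>A normalized rank is a count between 0 and \<open>n\<close> divided by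
  \<open>n + 1\<close>, whatever the data, ties included.\<close>

lemma finite_range_nranks: "finite (range (\<lambda>(x, y). nranks n x y))"
proof -
  let ?S = "(\<lambda>k. real k / (real n + 1)) ` {..n}"
  have "nrank n x i \<in> ?S" for x i
  proof
    let ?k = "card ({..<n} \<inter> {j. x j \<le> x i})"
    show "nrank n x i = real ?k / (real n + 1)" by (simp add: nrank_def rescaled_edf_def)
    have "?k \<le> card {..<n}" by (rule card_mono) auto
    then show "?k \<in> {..n}" by simp
  qed
  then have "range (\<lambda>(x, y). nranks n x y) \<subseteq> {xs. set xs \<subseteq> ?S \<times> ?S \<and> length xs = n}"
    by (auto simp: nranks_def)
  then show ?thesis by (rule finite_subset) (intro finite_lists_length_eq finite_cartesian_product; simp)
qed

theorem proposition4:
  fixes C :: "(real ^ 'p) \<Rightarrow> real \<Rightarrow> real \<Rightarrow> real"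
    and \<O> :: "(real ^ 'p) set" and \<theta>\<^sub>0 :: "real ^ 'p"
    and M :: "'w measure" and X Y :: "nat \<Rightarrow> 'w \<Rightarrow> real" and H :: "(real \<times> real) measure"
    and T :: "(real \<times> real) list \<Rightarrow> real ^ 'p" and \<theta> :: "nat \<Rightarrow> 'w \<Rightarrow> real ^ 'p"
    and N :: "'v measure" and \<CC> :: "'v \<Rightarrow> real \<times> real \<Rightarrow> real" and \<Theta> :: "'v \<Rightarrow> real ^ 'p"
    and dA_P dA_CFG :: "(real ^ 'p) \<Rightarrow> real \<Rightarrow> real ^ 'p"
  assumes family: "\<And>\<eta>. \<eta> \<in> \<O> \<Longrightarrow> copula (C \<eta>) \<and> LTD (C \<eta>)"
    and true_param: "\<theta>\<^sub>0 \<in> \<O>"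
    and M: "prob_space M"
    and sample: "random_sample M X Y H"
    and sample_copula: "has_copula H (C \<theta>\<^sub>0)"
    and rank_based: "\<And>n \<omega>. n \<ge> 1 \<Longrightarrow> \<omega> \<in> space M \<Longrightarrow>
          \<theta> n \<omega> = T (nranks n (\<lambda>i. X i \<omega>) (\<lambda>i. Y i \<omega>))"
    and param_valued: "\<And>n \<omega>. n \<ge> 1 \<Longrightarrow> \<omega> \<in> space M \<Longrightarrow> \<theta> n \<omega> \<in> \<O>"
    and N: "prob_space N"
    and \<CC>_gaussian: "gaussian_process N ({0..1} \<times> {0..1}) \<CC>"
    and \<CC>_limit: "weakly_converges linf_unit_square
          M (\<lambda>n \<omega>. \<lambda>(u, v)\<in>{0..1} \<times> {0..1}. sqrt (real n) *
               (empirical_copula n (\<lambda>i. X i \<omega>) (\<lambda>i. Y i \<omega>) u v - C \<theta>\<^sub>0 u v))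
          N (\<lambda>\<omega>. restrict (\<CC> \<omega>) ({0..1} \<times> {0..1}))"
  shows
    "(regular_family \<O> (\<lambda>\<eta>. A_P (C \<eta>)) dA_P \<and>
      gaussian_pair N {0..1} (\<lambda>\<omega>. lim_P (C \<theta>\<^sub>0) (\<CC> \<omega>)) \<Theta> \<and>
      weakly_converges (prod_metric C_unit euclidean_metric)
        M (\<lambda>n \<omega>. (\<lambda>t\<in>{0..1}. sqrt (real n) *
                     (An_P n (\<lambda>i. X i \<omega>) (\<lambda>i. Y i \<omega>) t - A_P (C \<theta>\<^sub>0) t),
                   sqrt (real n) *\<^sub>R (\<theta> n \<omega> - \<theta>\<^sub>0)))
        N (\<lambda>\<omega>. (restrict (lim_P (C \<theta>\<^sub>0) (\<CC> \<omega>)) {0..1}, \<Theta> \<omega>))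
      \<longrightarrow>
      weakly_converges C_unit
        M (\<lambda>n \<omega>. \<lambda>t\<in>{0..1}. sqrt (real n) *
             (An_P n (\<lambda>i. X i \<omega>) (\<lambda>i. Y i \<omega>) t - A_P (C (\<theta> n \<omega>)) t))
        N (\<lambda>\<omega>. \<lambda>t\<in>{0..1}. lim_P (C \<theta>\<^sub>0) (\<CC> \<omega>) t - dA_P \<theta>\<^sub>0 t \<bullet> \<Theta> \<omega>))
     \<and>
     (regular_family \<O> (\<lambda>\<eta>. A_CFG (C \<eta>)) dA_CFG \<and>
      gaussian_pair N {0..1} (\<lambda>\<omega>. lim_CFG (C \<theta>\<^sub>0) (\<CC> \<omega>)) \<Theta> \<and>
      weakly_converges (prod_metric C_unit euclidean_metric)
        M (\<lambda>n \<omega>. (\<lambda>t\<in>{0..1}. sqrt (real n) *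
                     (An_CFG n (\<lambda>i. X i \<omega>) (\<lambda>i. Y i \<omega>) t - A_CFG (C \<theta>\<^sub>0) t),
                   sqrt (real n) *\<^sub>R (\<theta> n \<omega> - \<theta>\<^sub>0)))
        N (\<lambda>\<omega>. (restrict (lim_CFG (C \<theta>\<^sub>0) (\<CC> \<omega>)) {0..1}, \<Theta> \<omega>))
      \<longrightarrow>
      weakly_converges C_unit
        M (\<lambda>n \<omega>. \<lambda>t\<in>{0..1}. sqrt (real n) *
             (An_CFG n (\<lambda>i. X i \<omega>) (\<lambda>i. Y i \<omega>) t - A_CFG (C (\<theta> n \<omega>)) t))
        N (\<lambda>\<omega>. \<lambda>t\<in>{0..1}. lim_CFG (C \<theta>\<^sub>0) (\<CC> \<omega>) t - dA_CFG \<theta>\<^sub>0 t \<bullet> \<Theta> \<omega>))"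
proof -
  have range: "finite (\<theta> n ` space M)" if "n \<ge> 1" for n
  proof (rule finite_subset)
    show "\<theta> n ` space M \<subseteq> T ` range (\<lambda>(x, y). nranks n x y)"
      using rank_based[OF that] by auto
  qed (simp add: finite_range_nranks)
  \<comment> \<open>Each conjunct is the delta method for
    \<open>\<lambda>\<eta>. A_P (C \<eta>)\<close> or
    \<open>\<lambda>\<eta>. A_CFG (C \<eta>)\<close>; the LTD copulas supply continuity on the
    closed interval and the ranks supply the finite range.\<close>
  show ?thesis
    by (intro conjI impI; elim conjE;
        rule delta_method_C_unit[OF M N _ true_param _ param_valued range];
        (assumption | use family continuous_on_A_P continuous_on_A_CFG in blast))
qed

end
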